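(* Let $n\ge 2$, let $G=SL(n,\mathbb{C})$, and let $B\subset G$ be the Borel subgroup of upper triangular matrices. Then there is no nonconstant morphism from $\mathbb{P}^2$ to the full flag variety $G/B$.
   Context: Varieties are over $\mathbb{C}$, and morphism means morphism of algebraic varieties. $\mathbb{P}^m$ denotes $m$-dimensional complex projective space. *)

theory Defs
  imports
    "HOL-Analysis.Abstract_Topology_2"
    "HOL-Library.Poly_Mapping"
    "HOL-Algebra.Coset"
    "Jordan_Normal_Form.Determinant"
begin

section \<open>Multivariate polynomials over the complex numbers\<close>

text \<open>Variables are indexed by a type; a monomial is its exponent vector. Multiplication of
  polynomials is the convolution product of \<^theory>\<open>HOL-Library.Poly_Mapping\<close>.\<close>

type_synonym 'i cpoly = "('i \<Rightarrow>\<^sub>0 nat) \<Rightarrow>\<^sub>0 complex"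

definition eval_monom :: "('i \<Rightarrow>\<^sub>0 nat) \<Rightarrow> ('i \<Rightarrow> complex) \<Rightarrow> complex" where
  "eval_monom m x = (\<Prod>i\<in>Poly_Mapping.keys m. x i ^ Poly_Mapping.lookup m i)"

definition eval_poly :: "'i cpoly \<Rightarrow> ('i \<Rightarrow> complex) \<Rightarrow> complex" where
  "eval_poly p x = (\<Sum>m\<in>Poly_Mapping.keys p. Poly_Mapping.lookup p m * eval_monom m x)"

definition total_deg :: "('i \<Rightarrow>\<^sub>0 nat) \<Rightarrow> nat" where
  "total_deg m = (\<Sum>i\<in>Poly_Mapping.keys m. Poly_Mapping.lookup m i)"

definition polys_in :: "'i set \<Rightarrow> 'i cpoly set" where
  "polys_in I = {p. \<forall>m\<in>Poly_Mapping.keys p. Poly_Mapping.keys m \<subseteq> I}"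

definition hom_polys_in :: "'i set \<Rightarrow> nat \<Rightarrow> 'i cpoly set" where
  "hom_polys_in I d = {p \<in> polys_in I. \<forall>m\<in>Poly_Mapping.keys p. total_deg m = d}"

lemma eval_monom_superset:
  "finite S \<Longrightarrow> Poly_Mapping.keys m \<subseteq> S \<Longrightarrow>
    eval_monom m x = (\<Prod>i\<in>S. x i ^ Poly_Mapping.lookup m i)"
  unfolding eval_monom_def by (rule prod.mono_neutral_left) (auto simp: in_keys_iff)

lemma eval_poly_superset:
  "finite S \<Longrightarrow> Poly_Mapping.keys p \<subseteq> S \<Longrightarrow>
    eval_poly p x = (\<Sum>m\<in>S. Poly_Mapping.lookup p m * eval_monom m x)"
  unfolding eval_poly_def by (rule sum.mono_neutral_left) (auto simp: in_keys_iff)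

lemma total_deg_superset:
  "finite S \<Longrightarrow> Poly_Mapping.keys m \<subseteq> S \<Longrightarrow>
    total_deg m = (\<Sum>i\<in>S. Poly_Mapping.lookup m i)"
  unfolding total_deg_def by (rule sum.mono_neutral_left) (auto simp: in_keys_iff)

lemma eval_monom_add: "eval_monom (m + m') x = eval_monom m x * eval_monom m' x"
proof -
  let ?S = "Poly_Mapping.keys m \<union> Poly_Mapping.keys m'"
  have "Poly_Mapping.keys (m + m') \<subseteq> ?S" by (rule Poly_Mapping.keys_add)
  then show ?thesis
    by (simp add: eval_monom_superset[of ?S] lookup_add power_add prod.distrib)
qed

lemma total_deg_add: "total_deg (m + m') = total_deg m + total_deg m'"
proof -
  let ?S = "Poly_Mapping.keys m \<union> Poly_Mapping.keys m'"
  have "Poly_Mapping.keys (m + m') \<subseteq> ?S" by (rule Poly_Mapping.keys_add)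
  then show ?thesis
    by (simp add: total_deg_superset[of ?S] lookup_add sum.distrib)
qed

lemma eval_poly_zero [simp]: "eval_poly 0 x = 0"
  by (simp add: eval_poly_def)

lemma eval_poly_add: "eval_poly (p + q) x = eval_poly p x + eval_poly q x"
proof -
  let ?S = "Poly_Mapping.keys p \<union> Poly_Mapping.keys q"
  have "Poly_Mapping.keys (p + q) \<subseteq> ?S" by (rule Poly_Mapping.keys_add)
  then show ?thesis
    by (simp add: eval_poly_superset[of ?S] lookup_add ring_distribs sum.distrib)
qed

lemma eval_poly_sum: "eval_poly (sum f A) x = (\<Sum>a\<in>A. eval_poly (f a) x)"
  by (induction A rule: infinite_finite_induct) (auto simp: eval_poly_add)

lemma eval_poly_single: "eval_poly (Poly_Mapping.single m c) x = c * eval_monom m x"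
  by (auto simp: eval_poly_def)

lemma cpoly_expand:
  "p = (\<Sum>m\<in>Poly_Mapping.keys p. Poly_Mapping.single m (Poly_Mapping.lookup p m))"
  by (rule poly_mapping_eqI) (simp add: lookup_sum lookup_single when_def in_keys_iff sum.delta)

lemma eval_poly_mult: "eval_poly (p * q) x = eval_poly p x * eval_poly q x"
proof -
  have "eval_poly (p * q) x =
      eval_poly ((\<Sum>m\<in>Poly_Mapping.keys p. Poly_Mapping.single m (Poly_Mapping.lookup p m)) *
        (\<Sum>m\<in>Poly_Mapping.keys q. Poly_Mapping.single m (Poly_Mapping.lookup q m))) x"
    by (simp flip: cpoly_expand)
  also have "\<dots> = eval_poly p x * eval_poly q x"
    unfolding eval_poly_def[of p] eval_poly_def[of q]
    by (simp add: sum_product eval_poly_sum mult_single eval_poly_single eval_monom_add mult_ac)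
  finally show ?thesis .
qed

lemma polys_in_mult:
  assumes "p \<in> polys_in I" "q \<in> polys_in I"
  shows "p * q \<in> polys_in I"
proof -
  have "Poly_Mapping.keys m \<subseteq> I" if "m \<in> Poly_Mapping.keys (p * q)" for m
  proof -
    obtain a b where ab: "a \<in> Poly_Mapping.keys p" "b \<in> Poly_Mapping.keys q" "m = a + b"
      using \<open>m \<in> Poly_Mapping.keys (p * q)\<close> keys_mult[of p q] by blast
    then show ?thesis
      using assms Poly_Mapping.keys_add[of a b] unfolding polys_in_def by blast
  qed
  then show ?thesis by (simp add: polys_in_def)
qed

lemma hom_polys_in_mult:
  assumes "p \<in> hom_polys_in I d" "q \<in> hom_polys_in I e"
  shows "p * q \<in> hom_polys_in I (d + e)"
proof -
  have "total_deg m = d + e" if "m \<in> Poly_Mapping.keys (p * q)" for m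
    using keys_mult[of p q] that assms by (auto simp: hom_polys_in_def total_deg_add)
  then show ?thesis
    using assms polys_in_mult[of p I q] by (simp add: hom_polys_in_def)
qed


section \<open>Spaces with functions and morphisms\<close>

text \<open>Varieties over \<open>\<complex>\<close> are treated in the classical way, as topological spaces of closed points
  with a sheaf of complex-valued functions. \<open>regular X U\<close> is the set of functions that are regular
  on the open set \<open>U\<close>; membership depends only on the values on \<open>U\<close>.\<close>

record 'a fspace =
  zariski :: "'a topology"
  regular :: "'a set \<Rightarrow> ('a \<Rightarrow> complex) set"

definition points :: "'a fspace \<Rightarrow> 'a set" where
  "points X = topspace (zariski X)"

definition morphism :: "'a fspace \<Rightarrow> 'b fspace \<Rightarrow> ('a \<Rightarrow> 'b) \<Rightarrow> bool" where
  "morphism X Y \<phi> \<longleftrightarrow>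
     continuous_map (zariski X) (zariski Y) \<phi> \<and>
     (\<forall>V f. openin (zariski Y) V \<longrightarrow> f \<in> regular Y V \<longrightarrow>
        f \<circ> \<phi> \<in> regular X {x \<in> points X. \<phi> x \<in> V})"

lemma istopology_zero_loci:
  fixes X :: "'a set" and H :: "'b set" and Z :: "'b \<Rightarrow> 'a \<Rightarrow> bool"
  assumes mult: "\<And>p q. p \<in> H \<Longrightarrow> q \<in> H \<Longrightarrow> t p q \<in> H"
    and Z: "\<And>p q x. p \<in> H \<Longrightarrow> q \<in> H \<Longrightarrow> x \<in> X \<Longrightarrow> Z (t p q) x \<longleftrightarrow> Z p x \<or> Z q x"
  shows "istopology (\<lambda>U. \<exists>F\<subseteq>H. U = {x \<in> X. \<not> (\<forall>p\<in>F. Z p x)})"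
  unfolding istopology_def
proof (intro conjI allI impI)
  let ?U = "\<lambda>F. {x \<in> X. \<not> (\<forall>p\<in>F. Z p x)}"
  fix S T assume "\<exists>F\<subseteq>H. S = ?U F" "\<exists>F\<subseteq>H. T = ?U F"
  then obtain F G where F: "F \<subseteq> H" "S = ?U F" and G: "G \<subseteq> H" "T = ?U G" by auto
  define FG where "FG = (\<lambda>(p, q). t p q) ` (F \<times> G)"
  have FG: "(\<forall>r\<in>FG. Z r x) \<longleftrightarrow> (\<forall>p\<in>F. \<forall>q\<in>G. Z (t p q) x)" for x
    by (auto simp: FG_def)
  have *: "Z (t p q) x \<longleftrightarrow> Z p x \<or> Z q x" if "p \<in> F" "q \<in> G" "x \<in> X" for p q x
    using Z F(1) G(1) that by blast
  have eq: "x \<in> S \<inter> T \<longleftrightarrow> x \<in> ?U FG" for x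
  proof (cases "x \<in> X")
    case True
    then show ?thesis unfolding F(2) G(2) using FG[of x] *[OF _ _ True] by auto
  next
    case False
    then show ?thesis by (simp add: F(2))
  qed
  have "S \<inter> T = ?U FG" by (rule Set.set_eqI) (rule eq)
  moreover have "FG \<subseteq> H" using mult F(1) G(1) by (auto simp: FG_def)
  ultimately show "\<exists>F\<subseteq>H. S \<inter> T = ?U F" by (intro exI[of _ FG] conjI)
next
  let ?U = "\<lambda>F. {x \<in> X. \<not> (\<forall>p\<in>F. Z p x)}"
  fix \<K> assume K: "\<forall>K\<in>\<K>. \<exists>F\<subseteq>H. K = ?U F"
  from bchoice[OF K] obtain \<F> where \<F>: "\<forall>K\<in>\<K>. \<F> K \<subseteq> H \<and> K = ?U (\<F> K)" ..
  have mem: "x \<in> K \<longleftrightarrow> x \<in> ?U (\<F> K)" if "K \<in> \<K>" for x K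
    by (rule arg_cong[where f = "\<lambda>S. x \<in> S", OF conjunct2[OF bspec[OF \<F> that]]])
  have eq: "x \<in> \<Union>\<K> \<longleftrightarrow> x \<in> ?U (\<Union>K\<in>\<K>. \<F> K)" for x
  proof -
    have "x \<in> \<Union>\<K> \<longleftrightarrow> (\<exists>K\<in>\<K>. x \<in> ?U (\<F> K))"
      unfolding Union_iff by (rule bex_cong[OF refl mem])
    also have "\<dots> \<longleftrightarrow> x \<in> ?U (\<Union>K\<in>\<K>. \<F> K)" by auto
    finally show ?thesis .
  qed
  have "\<Union>\<K> = ?U (\<Union>K\<in>\<K>. \<F> K)" by (rule Set.set_eqI) (rule eq)
  moreover have "(\<Union>K\<in>\<K>. \<F> K) \<subseteq> H" using \<F> by (intro UN_least) (rule conjunct1, erule (1) bspec)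
  ultimately show "\<exists>F\<subseteq>H. \<Union>\<K> = ?U F" by (intro exI[of _ "\<Union>K\<in>\<K>. \<F> K"] conjI)
qed

text \<open>The quotient of \<open>X\<close> by the fibres of \<open>\<pi>\<close>: a set is open iff its preimage is, and a function is
  regular iff its pullback is. For an algebraic group \<open>G\<close>, a closed subgroup \<open>H\<close> and
  \<open>\<pi> g = gH\<close> this is the variety structure on \<open>G/H\<close>.\<close>

definition quotient_fspace :: "'a fspace \<Rightarrow> ('a \<Rightarrow> 'b) \<Rightarrow> 'b fspace" where
  "quotient_fspace X \<pi> =
     \<lparr>zariski = topology (\<lambda>V. V \<subseteq> \<pi> ` points X \<and> openin (zariski X) {x \<in> points X. \<pi> x \<in> V}),
      regular = (\<lambda>V. {f. f \<circ> \<pi> \<in> regular X {x \<in> points X. \<pi> x \<in> V}})\<rparr>"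

lemma openin_quotient_fspace:
  "openin (zariski (quotient_fspace X \<pi>)) V \<longleftrightarrow>
     V \<subseteq> \<pi> ` points X \<and> openin (zariski X) {x \<in> points X. \<pi> x \<in> V}"
proof -
  let ?P = "\<lambda>V. {x \<in> points X. \<pi> x \<in> V}"
  have "istopology (\<lambda>V. V \<subseteq> \<pi> ` points X \<and> openin (zariski X) (?P V))"
    unfolding istopology_def
  proof (intro conjI allI impI)
    fix S T assume a: "S \<subseteq> \<pi> ` points X \<and> openin (zariski X) (?P S)"
      "T \<subseteq> \<pi> ` points X \<and> openin (zariski X) (?P T)"
    have "?P (S \<inter> T) = ?P S \<inter> ?P T" by blast
    with a show "S \<inter> T \<subseteq> \<pi> ` points X" "openin (zariski X) (?P (S \<inter> T))" by auto
  next
    fix \<K> assume a: "\<forall>K\<in>\<K>. K \<subseteq> \<pi> ` points X \<and> openin (zariski X) (?P K)"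
    have "?P (\<Union>\<K>) = (\<Union>K\<in>\<K>. ?P K)" by blast
    with a show "\<Union>\<K> \<subseteq> \<pi> ` points X" "openin (zariski X) (?P (\<Union>\<K>))" by auto
  qed
  then show ?thesis by (simp add: quotient_fspace_def)
qed

lemma points_quotient_fspace: "points (quotient_fspace X \<pi>) = \<pi> ` points X"
proof -
  have "{x \<in> points X. \<pi> x \<in> \<pi> ` points X} = topspace (zariski X)"
    by (auto simp: points_def)
  then have "openin (zariski (quotient_fspace X \<pi>)) (\<pi> ` points X)"
    by (simp add: openin_quotient_fspace)
  then show ?thesis
    unfolding points_def[of "quotient_fspace X \<pi>"] topspace_def
    by (auto simp: openin_quotient_fspace)
qed


section \<open>Projective space\<close>

definition proj_point :: "complex vec \<Rightarrow> complex vec set" where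
  "proj_point v = {c \<cdot>\<^sub>v v | c. c \<noteq> 0}"

definition proj_points :: "nat \<Rightarrow> complex vec set set" where
  "proj_points m = proj_point ` {v \<in> carrier_vec (m + 1). v \<noteq> 0\<^sub>v (m + 1)}"

abbreviation eval_at_vec :: "nat cpoly \<Rightarrow> complex vec \<Rightarrow> complex" where
  "eval_at_vec p v \<equiv> eval_poly p (\<lambda>i. v $ i)"

text \<open>Open sets are the complements of zero loci of arbitrary sets of homogeneous polynomials, and
  regular functions are locally quotients of homogeneous polynomials of equal degree.\<close>

definition proj_open :: "nat \<Rightarrow> complex vec set set \<Rightarrow> bool" where
  "proj_open m U \<longleftrightarrow> (\<exists>F \<subseteq> (\<Union>d. hom_polys_in {..m} d).
      U = {L \<in> proj_points m. \<not> (\<forall>p\<in>F. \<forall>v\<in>L. eval_at_vec p v = 0)})"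

definition proj_space :: "nat \<Rightarrow> complex vec set fspace" where
  "proj_space m =
     \<lparr>zariski = topology (proj_open m),
      regular = (\<lambda>U. {f. \<forall>L\<in>U. \<exists>V d. \<exists>p \<in> hom_polys_in {..m} d. \<exists>q \<in> hom_polys_in {..m} d.
         proj_open m V \<and> L \<in> V \<and> V \<subseteq> U \<and>
         (\<forall>M\<in>V. \<forall>v\<in>M. eval_at_vec q v \<noteq> 0 \<and> f M = eval_at_vec p v / eval_at_vec q v)})\<rparr>"

lemma proj_point_self: "v \<in> proj_point v"
  unfolding proj_point_def by (rule CollectI, rule exI[of _ 1]) simp

lemma eval_monom_smult_vec:
  assumes "v \<in> carrier_vec (m + 1)" "Poly_Mapping.keys a \<subseteq> {..m}"
  shows "eval_monom a (\<lambda>i. (c \<cdot>\<^sub>v v) $ i) = c ^ total_deg a * eval_monom a (\<lambda>i. v $ i)"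
proof -
  have "eval_monom a (\<lambda>i. (c \<cdot>\<^sub>v v) $ i) =
      (\<Prod>i\<in>Poly_Mapping.keys a. c ^ Poly_Mapping.lookup a i * (v $ i) ^ Poly_Mapping.lookup a i)"
    unfolding eval_monom_def
  proof (rule prod.cong)
    fix i assume "i \<in> Poly_Mapping.keys a"
    with assms have "i < dim_vec v" by auto
    then show "(c \<cdot>\<^sub>v v) $ i ^ Poly_Mapping.lookup a i =
        c ^ Poly_Mapping.lookup a i * (v $ i) ^ Poly_Mapping.lookup a i"
      by (simp add: power_mult_distrib)
  qed simp
  then show ?thesis
    by (simp add: prod.distrib eval_monom_def total_deg_def power_sum)
qed

lemma eval_at_smult_vec:
  assumes "v \<in> carrier_vec (m + 1)" "p \<in> hom_polys_in {..m} d"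
  shows "eval_at_vec p (c \<cdot>\<^sub>v v) = c ^ d * eval_at_vec p v"
proof -
  have "eval_at_vec p (c \<cdot>\<^sub>v v) =
      (\<Sum>a\<in>Poly_Mapping.keys p. Poly_Mapping.lookup p a * (c ^ d * eval_monom a (\<lambda>i. v $ i)))"
    unfolding eval_poly_def
  proof (rule sum.cong)
    fix a assume "a \<in> Poly_Mapping.keys p"
    with assms(2) have "Poly_Mapping.keys a \<subseteq> {..m}" "total_deg a = d"
      by (auto simp: hom_polys_in_def polys_in_def)
    with assms(1) show "Poly_Mapping.lookup p a * eval_monom a (\<lambda>i. (c \<cdot>\<^sub>v v) $ i) =
        Poly_Mapping.lookup p a * (c ^ d * eval_monom a (\<lambda>i. v $ i))"
      by (simp add: eval_monom_smult_vec)
  qed simp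
  then show ?thesis
    by (simp add: eval_poly_def sum_distrib_left mult_ac)
qed

lemma hom_vanish_proj_point:
  assumes "v \<in> carrier_vec (m + 1)" "p \<in> hom_polys_in {..m} d"
  shows "(\<forall>w\<in>proj_point v. eval_at_vec p w = 0) \<longleftrightarrow> eval_at_vec p v = 0"
proof -
  show ?thesis
    using proj_point_self[of v] eval_at_smult_vec[OF assms] by (auto simp: proj_point_def)
qed

lemma hom_vanish_mult:
  assumes "L \<in> proj_points m" "p \<in> hom_polys_in {..m} d" "q \<in> hom_polys_in {..m} e"
  shows "(\<forall>v\<in>L. eval_at_vec (p * q) v = 0) \<longleftrightarrow>
    (\<forall>v\<in>L. eval_at_vec p v = 0) \<or> (\<forall>v\<in>L. eval_at_vec q v = 0)"
proof -
  obtain v where v: "v \<in> carrier_vec (m + 1)" "L = proj_point v"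
    using assms(1) by (auto simp: proj_points_def)
  show ?thesis
    unfolding v(2) hom_vanish_proj_point[OF v(1) assms(2)] hom_vanish_proj_point[OF v(1) assms(3)]
      hom_vanish_proj_point[OF v(1) hom_polys_in_mult[OF assms(2,3)]]
    by (simp add: eval_poly_mult)
qed

lemma istopology_proj_open: "istopology (proj_open m)"
proof -
  let ?H = "\<Union>d. hom_polys_in {..m} d"
  have "istopology (\<lambda>U. \<exists>F\<subseteq>?H. U = {L \<in> proj_points m. \<not> (\<forall>p\<in>F. \<forall>v\<in>L. eval_at_vec p v = 0)})"
  proof (rule istopology_zero_loci[where t = "(*)"])
    fix p q assume "p \<in> ?H" "q \<in> ?H"
    then obtain d e where pq: "p \<in> hom_polys_in {..m} d" "q \<in> hom_polys_in {..m} e" by auto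
    show "p * q \<in> ?H" by (rule UN_I[OF UNIV_I]) (rule hom_polys_in_mult[OF pq])
    fix L assume "L \<in> proj_points m"
    then show "(\<forall>v\<in>L. eval_at_vec (p * q) v = 0) \<longleftrightarrow>
        (\<forall>v\<in>L. eval_at_vec p v = 0) \<or> (\<forall>v\<in>L. eval_at_vec q v = 0)"
      by (rule hom_vanish_mult[OF _ pq])
  qed
  then show ?thesis unfolding proj_open_def[abs_def] .
qed

lemma openin_proj_space: "openin (zariski (proj_space m)) U \<longleftrightarrow> proj_open m U"
  by (simp add: proj_space_def istopology_proj_open)


section \<open>The special linear group and its full flag variety\<close>

definition SL :: "nat \<Rightarrow> complex mat monoid" where
  "SL n = \<lparr>carrier = {A \<in> carrier_mat n n. det A = 1}, monoid.mult = (*), one = 1\<^sub>m n\<rparr>"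

definition borel :: "nat \<Rightarrow> complex mat set" where
  "borel n = {A \<in> carrier (SL n). upper_triangular A}"

abbreviation eval_at_mat :: "(nat \<times> nat) cpoly \<Rightarrow> complex mat \<Rightarrow> complex" where
  "eval_at_mat p A \<equiv> eval_poly p (\<lambda>ij. A $$ ij)"

abbreviation entry_polys :: "nat \<Rightarrow> (nat \<times> nat) cpoly set" where
  "entry_polys n \<equiv> polys_in ({..<n} \<times> {..<n})"

text \<open>\<open>SL n\<close> as a closed subvariety of the affine space of \<open>n \<times> n\<close> matrices.\<close>

definition SL_open :: "nat \<Rightarrow> complex mat set \<Rightarrow> bool" where
  "SL_open n U \<longleftrightarrow> (\<exists>F \<subseteq> entry_polys n.
      U = {A \<in> carrier (SL n). \<not> (\<forall>p\<in>F. eval_at_mat p A = 0)})"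

definition SL_variety :: "nat \<Rightarrow> complex mat fspace" where
  "SL_variety n =
     \<lparr>zariski = topology (SL_open n),
      regular = (\<lambda>U. {f. \<forall>A\<in>U. \<exists>V. \<exists>p \<in> entry_polys n. \<exists>q \<in> entry_polys n.
         SL_open n V \<and> A \<in> V \<and> V \<subseteq> U \<and>
         (\<forall>M\<in>V. eval_at_mat q M \<noteq> 0 \<and> f M = eval_at_mat p M / eval_at_mat q M)})\<rparr>"

lemma istopology_SL_open: "istopology (SL_open n)"
proof -
  have "istopology (\<lambda>U. \<exists>F\<subseteq>entry_polys n.
      U = {A \<in> carrier (SL n). \<not> (\<forall>p\<in>F. eval_at_mat p A = 0)})"
    by (rule istopology_zero_loci[where t = "(*)"]) (auto simp: polys_in_mult eval_poly_mult)
  then show ?thesis unfolding SL_open_def[abs_def] .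
qed

lemma openin_SL_variety: "openin (zariski (SL_variety n)) U \<longleftrightarrow> SL_open n U"
  by (simp add: SL_variety_def istopology_SL_open)

definition flag_variety :: "nat \<Rightarrow> complex mat set fspace" where
  "flag_variety n = quotient_fspace (SL_variety n) (\<lambda>g. g <#\<^bsub>SL n\<^esub> borel n)"

lemma eval_poly_one [simp]: "eval_poly 1 x = 1"
proof -
  have "eval_poly (Poly_Mapping.single 0 1) x = 1"
    unfolding eval_poly_single by (simp add: eval_monom_def)
  then show ?thesis by simp
qed

lemma one_hom_polys_in: "1 \<in> hom_polys_in I 0"
  by (auto simp: hom_polys_in_def polys_in_def total_deg_def)

lemma points_proj_space: "points (proj_space m) = proj_points m"
proof -
  have ne: "\<exists>v. v \<in> L" if "L \<in> proj_points m" for L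
  proof -
    obtain v where "L = proj_point v" using \<open>L \<in> proj_points m\<close> unfolding proj_points_def by blast
    then show ?thesis using proj_point_self by blast
  qed
  have "proj_points m = {L \<in> proj_points m. \<not> (\<forall>p\<in>{1}. \<forall>v\<in>L. eval_at_vec p v = 0)}"
    using ne by auto
  then have "proj_open m (proj_points m)"
    unfolding proj_open_def using one_hom_polys_in[of "{..m}"] by (intro exI[of _ "{1}"]) blast
  then show ?thesis
    unfolding points_def topspace_def openin_proj_space by (auto simp: proj_open_def)
qed

lemma points_SL_variety: "points (SL_variety n) = carrier (SL n)"
proof -
  have "carrier (SL n) = {A \<in> carrier (SL n). \<not> (\<forall>p\<in>{1}. eval_at_mat p A = 0)}" by simp
  moreover have "{1} \<subseteq> entry_polys n" using one_hom_polys_in by (auto simp: hom_polys_in_def)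
  ultimately have "SL_open n (carrier (SL n))" unfolding SL_open_def by blast
  then show ?thesis
    unfolding points_def topspace_def openin_SL_variety by (auto simp: SL_open_def)
qed

lemma points_flag_variety:
  "points (flag_variety n) = (\<lambda>g. g <#\<^bsub>SL n\<^esub> borel n) ` carrier (SL n)"
  by (simp add: flag_variety_def points_quotient_fspace points_SL_variety)

end

theory Submission
  imports
    Defs
    "HOL-Analysis.Continuum_Not_Denumerable"
    "HOL-Computational_Algebra.Field_as_Ring"
    "HOL-Computational_Algebra.Polynomial_Factorial"
    "HOL-Computational_Algebra.Fundamental_Theorem_Algebra"
    "Jordan_Normal_Form.Char_Poly"
begin

text \<open>Pull the morphism back to \<open>\<complex>\<^sup>3 - {0}\<close>. There every line bundle is trivial, because
  \<open>\<complex>[x, y, z]\<close> is factorial, and every extension of trivial bundles splits, because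
  \<open>H\<^sup>1(\<complex>\<^sup>3 - {0}, \<O>) = 0\<close>. Hence the flag of subbundles of the trivial bundle of rank \<open>n\<close> has a
  global basis, that is, the map to \<open>G/B\<close> lifts to a matrix \<open>g\<close> that is invertible over
  \<open>\<complex>[x, y, z]\<close>. Such a lift extends over the origin, and since the map is invariant under scaling,
  letting the scaling factor tend to \<open>0\<close> shows that it is constantly \<open>g(0) B\<close>.\<close>

section \<open>Ideals of polynomials in three variables\<close>

text \<open>A lift must be global before it can be evaluated at the origin, while a morphism
  provides only local ones: polynomial matrices whose determinants may have zeros. Sections of the
  subbundle of rank k are therefore encoded as a saturated submodule \<open>M k\<close>, cut out
  over the fraction field by one fixed frame. The quotient of \<open>M (Suc k)\<close> by
  \<open>M k\<close> is isomorphic to an ideal of polynomials. Unique factorisation takes out its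
  greatest common divisor \<open>e\<close> and leaves an ideal with no zero off the origin. By a
  Nullstellensatz, proved here from the uncountability of the complex numbers, that ideal contains
  powers of x, y and z, and the vanishing of cohomology then shows that \<open>e\<close> itself is
  attained. An element with value \<open>e\<close> extends a basis of \<open>M k\<close> to one of
  \<open>M (Suc k)\<close>. Three variables are essential: the third one turns the obstruction on
  the overlap of two charts into a coboundary. With two variables the argument must fail, since P^1
  is itself the flag variety of SL(2,C).\<close>

type_synonym ring3 = "complex poly poly poly"

definition const :: "complex \<Rightarrow> ring3" where
  "const c = [:[:[:c:]:]:]"

text \<open>The nesting inherits unique factorisation from the one-variable case. x is innermost and
  z outermost, so the coefficient of x^i y^j z^k in \<open>p\<close> is
  \<open>coeff (coeff (coeff p k) j) i\<close>. Every index from 2 on denotes z.\<close>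

definition var :: "nat \<Rightarrow> ring3" where
  "var i = (if i = 0 then [:[:[:0, 1:]:]:] else if i = 1 then [:[:0, 1:]:] else [:0, 1:])"

definition ev :: "(nat \<Rightarrow> complex) \<Rightarrow> ring3 \<Rightarrow> complex" where
  "ev w p = poly (poly (poly p [:[:w 2:]:]) [:w 1:]) (w 0)"

interpretation ev: comm_ring_hom "ev w"
  by standard (simp_all add: ev_def)

interpretation const: comm_ring_hom const
  by standard (simp_all add: const_def one_pCons)

lemma ev_const [simp]: "ev w (const c) = c"
  by (simp add: ev_def const_def)

lemma ev_var [simp]: "i < 3 \<Longrightarrow> ev w (var i) = w i"
  by (auto simp: ev_def var_def numeral_3_eq_3 numeral_2_eq_2 less_Suc_eq)

lemma poly_zero_on_infinite:
  fixes p :: "'a::{idom} poly"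
  assumes "infinite A" "\<And>a. a \<in> A \<Longrightarrow> poly p a = 0"
  shows "p = 0"
  using assms poly_roots_finite[of p] by (metis (mono_tags, lifting) finite_subset mem_Collect_eq subsetI)

text \<open>With the outer variables fixed, a one-variable polynomial has infinitely many roots.
  Leaving out the plane z = 0 keeps the test points off the origin, where the pointwise data are
  defined.\<close>

lemma ev_eq_0_imp:
  assumes "\<And>w. w 2 \<noteq> 0 \<Longrightarrow> ev w p = 0"
  shows "p = 0"
proof -
  have inf: "infinite (UNIV - {0::complex})"
    by (simp add: infinite_UNIV_char_0)
  have 1: "poly (poly (poly p [:[:c:]:]) [:b:]) a = 0" if "c \<noteq> 0" for a b c
    using assms[of "\<lambda>i. if i = 0 then a else if i = 1 then b else c"] that by (simp add: ev_def)
  have 2: "poly (poly p [:[:c:]:]) [:b:] = 0" if "c \<noteq> 0" for b c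
    by (rule poly_zero_on_infinite[of UNIV]) (simp_all add: 1 that infinite_UNIV_char_0)
  have inj1: "inj (\<lambda>b::complex. [:b:])" and inj2: "inj (\<lambda>b::complex. [:[:b:]:])"
    by (auto simp: inj_def)
  have 3: "poly p [:[:c:]:] = 0" if "c \<noteq> 0" for c
    by (rule poly_zero_on_infinite[of "range (\<lambda>b. [:b:])"])
      (auto simp: 2 that finite_image_iff[OF inj1] infinite_UNIV_char_0)
  show ?thesis
    by (rule poly_zero_on_infinite[of "(\<lambda>c. [:[:c:]:]) ` (UNIV - {0})"])
      (use inf in \<open>auto simp: 3 finite_image_iff inj_on_subset[OF inj2]\<close>)
qed

section \<open>Nullstellensatz for ideals without zeros off the origin\<close>

definition is_ideal :: "'a::comm_ring_1 set \<Rightarrow> bool" where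
  "is_ideal I \<longleftrightarrow> 0 \<in> I \<and> (\<forall>a\<in>I. \<forall>b\<in>I. a + b \<in> I) \<and> (\<forall>a\<in>I. \<forall>r. r * a \<in> I)"

lemma is_ideal_sum:
  "is_ideal I \<Longrightarrow> (\<And>x. x \<in> A \<Longrightarrow> f x \<in> I) \<Longrightarrow> sum f A \<in> I"
  by (induction A rule: infinite_finite_induct) (auto simp: is_ideal_def)

lemma is_ideal_diff: "is_ideal I \<Longrightarrow> a \<in> I \<Longrightarrow> b \<in> I \<Longrightarrow> a - b \<in> I"
  unfolding is_ideal_def by (metis mult_minus1 uminus_add_conv_diff add.commute)

text \<open>By Zorn's lemma choose \<open>P\<close> maximal among the ideals that contain
  \<open>J\<close> and no power of \<open>t\<close>: it is the trace of a maximal ideal of the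
  localisation at \<open>t\<close>. The last conclusion says that every \<open>a\<close> outside
  \<open>P\<close> becomes invertible modulo \<open>P\<close> once \<open>t\<close> is
  inverted.\<close>

lemma ex_maximal_ideal_avoiding_powers:
  fixes t :: "'a::comm_ring_1"
  assumes "is_ideal J" "\<And>N. t ^ N \<notin> J"
  obtains P where "is_ideal P" "J \<subseteq> P" "\<And>N. t ^ N \<notin> P"
    "\<And>a b. a * b \<in> P \<Longrightarrow> a \<in> P \<or> b \<in> P" "\<And>a. a \<notin> P \<Longrightarrow> \<exists>p N. a * p - t ^ N \<in> P"
proof -
  define \<A> where "\<A> = {I. is_ideal I \<and> J \<subseteq> I \<and> (\<forall>N. t ^ N \<notin> I)}"
  have "\<exists>M\<in>\<A>. \<forall>X\<in>\<A>. M \<subseteq> X \<longrightarrow> X = M"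
  proof (rule subset_Zorn_nonempty)
    show "\<A> \<noteq> {}" using assms by (auto simp: \<A>_def)
    fix \<C> assume C: "\<C> \<noteq> {}" "subset.chain \<A> \<C>"
    then have CA: "\<And>I. I \<in> \<C> \<Longrightarrow> is_ideal I \<and> J \<subseteq> I \<and> (\<forall>N. t ^ N \<notin> I)"
      by (auto simp: subset.chain_def \<A>_def)
    have tot: "I \<subseteq> I' \<or> I' \<subseteq> I" if "I \<in> \<C>" "I' \<in> \<C>" for I I'
      using C(2) that by (auto simp: subset.chain_def)
    have "is_ideal (\<Union>\<C>)"
      unfolding is_ideal_def
    proof (intro conjI ballI allI)
      show "0 \<in> \<Union>\<C>" using C(1) CA by (auto simp: is_ideal_def)
      show "r * a \<in> \<Union>\<C>" if "a \<in> \<Union>\<C>" for a r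
        using CA that unfolding is_ideal_def by blast
      fix a b assume "a \<in> \<Union>\<C>" "b \<in> \<Union>\<C>"
      then obtain I I' where "I \<in> \<C>" "I' \<in> \<C>" "a \<in> I" "b \<in> I'" by auto
      then obtain I'' where "I'' \<in> \<C>" "a \<in> I''" "b \<in> I''" using tot[of I I'] by blast
      then show "a + b \<in> \<Union>\<C>" using CA unfolding is_ideal_def by blast
    qed
    then show "\<Union>\<C> \<in> \<A>" using C(1) CA by (auto simp: \<A>_def)
  qed
  then obtain P where P: "P \<in> \<A>" and max: "\<And>X. X \<in> \<A> \<Longrightarrow> P \<subseteq> X \<Longrightarrow> X = P" by blast
  have idP: "is_ideal P" using P by (simp add: \<A>_def)
  \<comment> \<open>By maximality the ideal generated by \<open>P\<close> and \<open>a\<close>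
    contains a power of \<open>t\<close>.\<close>
  have grow: "\<exists>N p r. p \<in> P \<and> t ^ N = p + r * a" if "a \<notin> P" for a
  proof (rule ccontr)
    assume neg: "\<not> ?thesis"
    define X where "X = {p + r * a | p r. p \<in> P}"
    have "is_ideal X"
      unfolding is_ideal_def
    proof (intro conjI ballI allI)
      show "0 \<in> X" unfolding X_def using idP by (intro CollectI exI[of _ 0]) (auto simp: is_ideal_def)
      fix x assume "x \<in> X"
      then obtain p r where x: "x = p + r * a" "p \<in> P" by (auto simp: X_def)
      show "s * x \<in> X" for s
        unfolding X_def
        by (rule CollectI, rule exI[of _ "s * p"], rule exI[of _ "s * r"])
          (use x idP in \<open>auto simp: is_ideal_def algebra_simps\<close>)
      fix y assume "y \<in> X"
      then obtain q s where y: "y = q + s * a" "q \<in> P" by (auto simp: X_def)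
      show "x + y \<in> X"
        unfolding X_def
        by (rule CollectI, rule exI[of _ "p + q"], rule exI[of _ "r + s"])
          (use x y idP in \<open>auto simp: is_ideal_def algebra_simps\<close>)
    qed
    moreover have PX: "P \<subseteq> X"
    proof
      fix p assume "p \<in> P"
      then show "p \<in> X" unfolding X_def by (intro CollectI exI[of _ p] exI[of _ 0]) auto
    qed
    moreover have "t ^ N \<notin> X" for N using neg by (auto simp: X_def)
    ultimately have "X = P" using P by (intro max) (auto simp: \<A>_def)
    moreover have "a \<in> X"
      unfolding X_def using idP by (intro CollectI exI[of _ 0] exI[of _ 1]) (auto simp: is_ideal_def)
    ultimately show False using that by simp
  qed
  have "a \<in> P \<or> b \<in> P" if "a * b \<in> P" for a b
  proof (rule ccontr)
    assume "\<not> ?thesis"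
    then obtain N p r M q s where *: "p \<in> P" "t ^ N = p + r * a" "q \<in> P" "t ^ M = q + s * b"
      using grow[of a] grow[of b] by blast
    have "t ^ (N + M) = (q + s * b) * p + ((r * a) * q + (r * s) * (a * b))"
      unfolding power_add * by (simp add: algebra_simps)
    also have "\<dots> \<in> P" using idP *(1,3) that by (auto simp: is_ideal_def)
    finally show False using P by (auto simp: \<A>_def)
  qed
  moreover have "\<exists>p N. a * p - t ^ N \<in> P" if "a \<notin> P" for a
  proof -
    obtain N p r where *: "p \<in> P" "t ^ N = p + r * a" using grow \<open>a \<notin> P\<close> by blast
    then have "a * r - t ^ N = (-1) * p" by (simp add: algebra_simps)
    also have "\<dots> \<in> P" using idP *(1) unfolding is_ideal_def by blast
    finally show ?thesis by blast
  qed
  ultimately show thesis using that[of P] P by (auto simp: \<A>_def)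
qed

text \<open>Gaussian elimination, one coordinate at a time: the pivot \<open>c0\<close> clears
  coordinate \<open>k\<close> from the remaining vectors, of which there are still infinitely
  many.\<close>

lemma infinite_family_dependent:
  fixes v :: "'c \<Rightarrow> 'k \<Rightarrow> 'a::field"
  assumes "finite K" "infinite S"
  shows "\<exists>A l. finite A \<and> A \<subseteq> S \<and> (\<exists>c\<in>A. l c \<noteq> 0) \<and> (\<forall>k\<in>K. (\<Sum>c\<in>A. l c * v c k) = 0)"
  using assms
proof (induction K arbitrary: S v rule: finite_induct)
  case empty
  then obtain c where "c \<in> S" by fastforce
  then show ?case by (intro exI[of _ "{c}"] exI[of _ "\<lambda>_. 1"]) auto
next
  case (insert k K)
  show ?case
  proof (cases "\<forall>c\<in>S. v c k = 0")
    case True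
    obtain A l where "finite A" "A \<subseteq> S" "\<exists>c\<in>A. l c \<noteq> 0" "\<forall>k\<in>K. (\<Sum>c\<in>A. l c * v c k) = 0"
      using insert.IH[OF insert.prems, of v] by blast
    moreover have "(\<Sum>c\<in>A. l c * v c k) = 0" using True \<open>A \<subseteq> S\<close> by (intro sum.neutral) auto
    ultimately show ?thesis by (intro exI[of _ A] exI[of _ l]) auto
  next
    case False
    then obtain c0 where c0: "c0 \<in> S" "v c0 k \<noteq> 0" by blast
    define v' where "v' = (\<lambda>c k'. v c k' - v c k / v c0 k * v c0 k')"
    obtain A l where A: "finite A" "A \<subseteq> S - {c0}" "\<exists>c\<in>A. l c \<noteq> 0"
        "\<forall>k\<in>K. (\<Sum>c\<in>A. l c * v' c k) = 0"
      using insert.IH[of "S - {c0}" v'] insert.prems by auto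
    \<comment> \<open>The coefficient of the pivot collects the multiples subtracted in
      \<open>v'\<close>.\<close>
    define l' where "l' = l(c0 := - (\<Sum>c\<in>A. l c * (v c k / v c0 k)))"
    have c0A: "c0 \<notin> A" using A by auto
    have *: "(\<Sum>c\<in>insert c0 A. l' c * v c k') = (\<Sum>c\<in>A. l c * v' c k')" for k'
    proof -
      have "(\<Sum>c\<in>insert c0 A. l' c * v c k') = l' c0 * v c0 k' + (\<Sum>c\<in>A. l' c * v c k')"
        using A c0A by simp
      also have "(\<Sum>c\<in>A. l' c * v c k') = (\<Sum>c\<in>A. l c * v c k')"
        using c0A by (intro sum.cong) (auto simp: l'_def)
      finally show ?thesis
        by (simp add: l'_def v'_def right_diff_distrib sum_subtractf sum_distrib_right mult.assoc)
    qed
    have "v' c k = 0" for c using c0 by (simp add: v'_def)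
    then have "\<forall>k'\<in>insert k K. (\<Sum>c\<in>insert c0 A. l' c * v c k') = 0"
      using A(4) by (simp add: * del: sum.insert)
    moreover have "\<exists>c\<in>insert c0 A. l' c \<noteq> 0" using A(3) c0A by (auto simp: l'_def)
    ultimately show ?thesis
      using A c0 by (intro exI[of _ "insert c0 A"] exI[of _ l']) auto
  qed
qed

text \<open>Polynomials with a common bound lie in a space of finite dimension, and there are only
  countably many bounds; both facts feed the counting argument below.\<close>

lemma ring3_coeff_bound:
  fixes p :: ring3
  shows "\<exists>N. \<forall>i j k. coeff (coeff (coeff p k) j) i \<noteq> 0 \<longrightarrow> i \<le> N \<and> j \<le> N \<and> k \<le> N"
proof -
  define K where "K = {..degree p}"
  define D1 where "D1 = Max ((\<lambda>k. degree (coeff p k)) ` K)"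
  define D2 where "D2 = Max ((\<lambda>(k,j). degree (coeff (coeff p k) j)) ` (K \<times> {..D1}))"
  have "i \<le> D2 \<and> j \<le> D1 \<and> k \<le> degree p" if nz: "coeff (coeff (coeff p k) j) i \<noteq> 0" for i j k
  proof -
    have "coeff p k \<noteq> 0" using nz by auto
    then have k: "k \<in> K" using le_degree by (auto simp: K_def)
    have "j \<le> degree (coeff p k)" using nz by (intro le_degree) auto
    also have "\<dots> \<le> D1" unfolding D1_def using k by (intro Max_ge) (auto simp: K_def)
    finally have j: "j \<le> D1" .
    have "i \<le> degree (coeff (coeff p k) j)" using nz by (intro le_degree) auto
    also have "\<dots> \<le> D2" unfolding D2_def using k j by (intro Max_ge) (auto simp: K_def)
    finally show ?thesis using j k by (auto simp: K_def)
  qed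
  then show ?thesis
    by (intro exI[of _ "max D2 (max D1 (degree p))"]) (auto simp: le_max_iff_disj)
qed

text \<open>An element algebraic modulo a prime ideal is a constant because the complex numbers are
  algebraically closed: split off one root of \<open>q\<close> at a time, and primality keeps one of
  the factors in \<open>P\<close>.\<close>

lemma prime_ideal_contains_linear_factor:
  fixes P :: "ring3 set"
  assumes id: "is_ideal P" and one: "1 \<notin> P" and prime: "\<And>a b. a * b \<in> P \<Longrightarrow> a \<in> P \<or> b \<in> P"
    and q: "q \<noteq> 0" "poly (map_poly const q) t \<in> P"
  shows "\<exists>c. t - const c \<in> P"
  using q
proof (induction "degree q" arbitrary: q)
  case 0
  then obtain c where c: "q = [:c:]" "c \<noteq> 0" using degree_eq_zeroE by (metis pCons_eq_0_iff)
  then have "const c \<in> P" using 0 by (simp add: map_poly_pCons)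
  then have "const (1 / c) * const c \<in> P" using id by (auto simp: is_ideal_def)
  then show ?case using one c by (simp flip: const.hom_mult)
next
  case (Suc d)
  have "\<not> constant (poly q)" using Suc.hyps(2) constant_degree[of q] by simp
  then obtain z where "poly q z = 0" using fundamental_theorem_of_algebra by blast
  then obtain r where r: "q = [:-z, 1:] * r" using poly_eq_0_iff_dvd[of q z] by (auto simp: dvd_def)
  have "r \<noteq> 0" using r Suc.prems by auto
  then have deg: "d = degree r" using Suc.hyps(2) unfolding r by (subst (asm) degree_mult_eq) auto
  interpret map_poly_comm_ring_hom const ..
  have "poly (map_poly const q) t = (t - const z) * poly (map_poly const r) t"
    unfolding r hom_distribs poly_mult by (simp add: map_poly_pCons hom_distribs)
  then have "t - const z \<in> P \<or> poly (map_poly const r) t \<in> P"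
    using prime Suc.prems(2) by metis
  then show ?case using Suc.hyps(1)[OF deg \<open>r \<noteq> 0\<close>] by blast
qed

text \<open>Modulo \<open>P\<close> and with \<open>t\<close> inverted, the elements 1/(s - c) form
  an uncountable family in an algebra of countable dimension. A linear relation between them makes
  \<open>s\<close> algebraic, hence constant, modulo \<open>P\<close>.\<close>

lemma prime_ideal_avoiding_power_linear:
  fixes P :: "ring3 set"
  assumes id: "is_ideal P" and prime: "\<And>a b. a * b \<in> P \<Longrightarrow> a \<in> P \<or> b \<in> P"
    and inv: "\<And>c. \<exists>p N. (s - const c) * p - t ^ N \<in> P"
    and t: "\<And>N. t ^ N \<notin> P"
  shows "\<exists>c. s - const c \<in> P"
proof -
  from inv obtain p N where pN: "\<And>c. (s - const c) * p c - t ^ N c \<in> P" by metis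
  from ring3_coeff_bound obtain B :: "ring3 \<Rightarrow> nat" where
    B: "\<And>p i j k. coeff (coeff (coeff p k) j) i \<noteq> 0 \<Longrightarrow> i \<le> B p \<and> j \<le> B p \<and> k \<le> B p"
    by metis
  \<comment> \<open>Pigeonhole: uncountably many \<open>c\<close>, but only countably many pairs of
    an exponent and a coefficient bound, so one pair occurs infinitely often.\<close>
  have "\<exists>y. infinite ((\<lambda>c. (N c, B (p c))) -` {y})"
  proof (rule ccontr)
    assume "\<not> ?thesis"
    then have "countable (\<Union>y. (\<lambda>c. (N c, B (p c))) -` {y})"
      by (intro countable_UN) (auto intro: countable_finite)
    moreover have "(\<Union>y. (\<lambda>c. (N c, B (p c))) -` {y}) = UNIV" by auto
    ultimately show False using uncountable_UNIV_complex by simp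
  qed
  then obtain n b where inf: "infinite ((\<lambda>c. (N c, B (p c))) -` {(n, b)})" (is "infinite ?S")
    by auto
  obtain A l where A: "finite A" "A \<subseteq> ?S" "\<exists>c\<in>A. l c \<noteq> 0"
    "\<forall>x\<in>{..b} \<times> {..b} \<times> {..b}. (\<Sum>c\<in>A. l c * (case x of (i,j,k) \<Rightarrow> coeff (coeff (coeff (p c) k) j) i)) = 0"
    using infinite_family_dependent[OF _ inf, of "{..b} \<times> {..b} \<times> {..b}"
      "\<lambda>c (i,j,k). coeff (coeff (coeff (p c) k) j) i"] by auto
  have 0: "(\<Sum>c\<in>A. const (l c) * p c) = 0"
  proof (intro poly_eqI)
    fix i j k
    have "(\<Sum>c\<in>A. l c * coeff (coeff (coeff (p c) k) j) i) = 0"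
    proof (cases "i \<le> b \<and> j \<le> b \<and> k \<le> b")
      case True
      then show ?thesis using A(4)[rule_format, of "(i,j,k)"] by simp
    next
      case False
      then have "coeff (coeff (coeff (p c) k) j) i = 0" if "c \<in> A" for c
        using B[of "p c" k j i] A(2) that by auto
      then show ?thesis by simp
    qed
    then show "coeff (coeff (coeff (\<Sum>c\<in>A. const (l c) * p c) k) j) i = coeff (coeff (coeff 0 k) j) i"
      by (simp add: coeff_sum const_def)
  qed
  \<comment> \<open>The numerator of the sum of l(c)/(X - c) over \<open>A\<close>. At a point
    \<open>c\<close> of \<open>A\<close> only the summand of \<open>c\<close> survives, so
    \<open>q\<close> is nonzero.\<close>
  define q where "q = (\<Sum>c\<in>A. smult (l c) (\<Prod>d\<in>A - {c}. [:-d, 1:]))"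
  interpret mp: map_poly_comm_ring_hom const ..
  have pq: "poly (map_poly const q) s = (\<Sum>c\<in>A. const (l c) * (\<Prod>d\<in>A - {c}. s - const d))"
    unfolding q_def
    by (simp add: mp.hom_sum mp.hom_prod poly_sum poly_prod const.map_poly_hom_smult map_poly_pCons const.hom_uminus)
  have "q \<noteq> 0"
  proof
    assume "q = 0"
    obtain c where c: "c \<in> A" "l c \<noteq> 0" using A by blast
    have "poly q c = (\<Sum>c'\<in>A. l c' * (\<Prod>d\<in>A - {c'}. c - d))"
      by (simp add: q_def poly_sum poly_prod)
    also have "\<dots> = (\<Sum>c'\<in>{c}. l c' * (\<Prod>d\<in>A - {c'}. c - d))"
      using A(1) c by (intro sum.mono_neutral_right) (auto intro!: prod_zero)
    also have "\<dots> \<noteq> 0" using A(1) c by simp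
    finally show False using \<open>q = 0\<close> by simp
  qed
  \<comment> \<open>Weight the congruences between (s - c) p(c) and t^n so that their sum clears the
    denominators: the left sides then contain the factor sum of l(c) p(c), which is zero.\<close>
  have "(\<Sum>c\<in>A. const (l c) * (\<Prod>d\<in>A - {c}. s - const d) * ((s - const c) * p c - t ^ n)) \<in> P"
    using A(2) pN id by (intro is_ideal_sum) (auto simp: is_ideal_def)
  also have "(\<Sum>c\<in>A. const (l c) * (\<Prod>d\<in>A - {c}. s - const d) * ((s - const c) * p c - t ^ n))
      = (\<Sum>c\<in>A. (\<Prod>d\<in>A. s - const d) * (const (l c) * p c)) - t ^ n * poly (map_poly const q) s"
    unfolding pq sum_distrib_left sum_subtractf[symmetric]
  proof (rule sum.cong)
    fix c assume "c \<in> A"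
    then have "(\<Prod>d\<in>A. s - const d) = (s - const c) * (\<Prod>d\<in>A - {c}. s - const d)"
      using A(1) by (rule prod.remove[rotated])
    moreover have "x = u * y \<Longrightarrow> v * y * (u * z - t ^ n) = x * (v * z) - t ^ n * (v * y)" for x u y v z :: ring3
      by (simp add: algebra_simps)
    ultimately show "const (l c) * (\<Prod>d\<in>A - {c}. s - const d) * ((s - const c) * p c - t ^ n) =
      (\<Prod>d\<in>A. s - const d) * (const (l c) * p c) - t ^ n * (const (l c) * (\<Prod>d\<in>A - {c}. s - const d))"
      by blast
  qed simp
  also have "\<dots> = - (t ^ n * poly (map_poly const q) s)"
    by (simp add: 0 flip: sum_distrib_left)
  finally have "t ^ n * poly (map_poly const q) s \<in> P"
    using id unfolding is_ideal_def by (metis mult_minus1 minus_minus)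
  then have "poly (map_poly const q) s \<in> P" using prime t by blast
  moreover have "1 \<notin> P" using t[of 0] by simp
  ultimately show ?thesis
    using prime_ideal_contains_linear_factor[OF id _ prime \<open>q \<noteq> 0\<close>] by blast
qed

text \<open>Remainder theorem in each variable, from the outermost inwards: the quotients
  \<open>r\<close>, \<open>r1\<close>, \<open>r2\<close> exhibit the difference as a combination of
  the three linear polynomials in \<open>P\<close>.\<close>

lemma ideal_contains_minus_ev:
  fixes P :: "ring3 set"
  assumes id: "is_ideal P" and P: "\<And>i. i < 3 \<Longrightarrow> var i - const (w i) \<in> P"
  shows "p - const (ev w p) \<in> P"
proof -
  define p1 where "p1 = poly p [:[:w 2:]:]"
  define p2 where "p2 = poly p1 [:w 1:]"
  have dv: "\<exists>r. q = [:-a, 1:] * r + [:poly q a:]" for q :: "'b::idom poly" and a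
  proof -
    have "poly (q - [:poly q a:]) a = 0" by simp
    then obtain r where "q - [:poly q a:] = [:-a, 1:] * r" unfolding poly_eq_0_iff_dvd dvd_def by blast
    then have "q = [:-a, 1:] * r + [:poly q a:]" by (metis diff_add_cancel)
    then show ?thesis by blast
  qed
  obtain r where r: "p = [:-[:[:w 2:]:], 1:] * r + [:p1:]" using dv unfolding p1_def by blast
  obtain r1 where r1: "p1 = [:-[:w 1:], 1:] * r1 + [:p2:]" using dv unfolding p2_def by blast
  obtain r2 where r2: "p2 = [:-w 0, 1:] * r2 + [:poly p2 (w 0):]" using dv by blast
  have v: "var 2 - const (w 2) = [:-[:[:w 2:]:], 1:]" "var 1 - const (w 1) = [:[:-[:w 1:], 1:]:]"
    "var 0 - const (w 0) = [:[:[:-w 0, 1:]:]:]"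
    by (simp_all add: var_def const_def)
  have 2: "[:[:p2:]:] = [:[:[:-w 0, 1:]:]:] * [:[:r2:]:] + const (poly p2 (w 0))"
    by (subst r2) (simp add: const_def)
  have 1: "[:p1:] = [:[:-[:w 1:], 1:]:] * [:r1:] + [:[:p2:]:]"
    by (subst r1) simp
  have gen: "a = b * r + q1 \<Longrightarrow> q1 = d * s + q2 \<Longrightarrow> q2 = e * u + k \<Longrightarrow> a - k = r * b + (s * d + u * e)"
    for a b r q1 d s q2 e u k :: ring3
    by (simp add: mult.commute)
  have "p - const (ev w p) = r * (var 2 - const (w 2)) + ([:r1:] * (var 1 - const (w 1)) +
      [:[:r2:]:] * (var 0 - const (w 0)))"
    using gen[OF r 1 2] unfolding v by (simp only: p1_def p2_def ev_def)
  then show ?thesis using id P[of 0] P[of 1] P[of 2] by (simp add: is_ideal_def del: mult_pCons_left)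
qed

text \<open>Otherwise an ideal \<open>P\<close> maximal among those avoiding the powers makes all
  variables constant, with values \<open>w\<close>. Off the origin, an element of \<open>J\<close>
  that is nonzero at \<open>w\<close> forces 1 into \<open>P\<close>; at the origin,
  \<open>var i\<close> itself lies in \<open>P\<close>. Either is a power that \<open>P\<close>
  avoids.\<close>

lemma var_power_in_ideal:
  fixes J :: "ring3 set"
  assumes J: "is_ideal J" and nz: "\<And>w. \<exists>i<3. w i \<noteq> 0 \<Longrightarrow> \<exists>p\<in>J. ev w p \<noteq> 0"
    and i: "i < 3"
  shows "\<exists>N. var i ^ N \<in> J"
proof (rule ccontr)
  assume "\<not> ?thesis"
  then obtain P where id: "is_ideal P" and JP: "J \<subseteq> P" and av: "\<And>N. var i ^ N \<notin> P"
    and prime: "\<And>a b. a * b \<in> P \<Longrightarrow> a \<in> P \<or> b \<in> P"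
    and max: "\<And>a. a \<notin> P \<Longrightarrow> \<exists>p N. a * p - var i ^ N \<in> P"
    using ex_maximal_ideal_avoiding_powers[OF J, of "var i"] by metis
  have "\<exists>c. var j - const c \<in> P" for j
  \<comment> \<open>Cases on the goal itself: its failure makes every \<open>var j - const c\<close>
    invertible after inverting \<open>var i\<close>, as the counting argument demands.\<close>
  proof (cases "\<exists>c. var j - const c \<in> P")
    case False
    then show ?thesis
      using max by (intro prime_ideal_avoiding_power_linear[OF id prime _ av]) auto
  qed
  then obtain w where w: "\<And>j. var j - const (w j) \<in> P" by metis
  show False
  proof (cases "\<exists>i<3. w i \<noteq> 0")
    case True
    then obtain p where p: "p \<in> J" "ev w p \<noteq> 0" using nz by blast
    have "p - (p - const (ev w p)) \<in> P"
      using JP p by (intro is_ideal_diff[OF id] ideal_contains_minus_ev[OF id] w) auto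
    then have "const (1 / ev w p) * const (ev w p) \<in> P" using id by (simp add: is_ideal_def)
    then show False using av[of 0] p by (simp flip: const.hom_mult)
  next
    case False
    then show False using w[of i] i av[of 1] by simp
  qed
qed

section \<open>Extending frames over the punctured space\<close>

text \<open>The regular sequence property of x^N, y^N, z^N made explicit: compare the coefficients
  of z^(m+N). \<open>poly_shift N\<close> divides by z^N and drops the remainder.\<close>

lemma var_power_koszul:
  fixes a b c :: ring3
  assumes "var 2 ^ N * c + var 0 ^ N * a + var 1 ^ N * b = 0"
  shows "\<exists>a' b'. c = var 0 ^ N * a' + var 1 ^ N * b'"
proof (intro exI)
  define x y :: "complex poly poly" where "x = [:[:0, 1:]:] ^ N" and "y = [:0, 1:] ^ N"
  have p: "[:t:] ^ N = [:t ^ N:]" for t :: "complex poly poly"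
    by (induction N) (auto simp: one_pCons)
  have z: "var 2 ^ N = monom 1 N" by (simp add: var_def monom_altdef)
  have 0: "monom 1 N * c + smult x a + smult y b = 0"
    using assms unfolding z by (simp add: var_def p x_def y_def)
  show "c = var 0 ^ N * (- poly_shift N a) + var 1 ^ N * (- poly_shift N b)"
  proof (rule poly_eqI)
    fix m
    have "coeff (monom 1 N * c + smult x a + smult y b) (m + N) = 0" unfolding 0 by simp
    then have "coeff c m + x * coeff a (m + N) + y * coeff b (m + N) = 0"
      by (simp add: coeff_monom_mult)
    then show "coeff c m = coeff (var 0 ^ N * (- poly_shift N a) + var 1 ^ N * (- poly_shift N b)) m"
      by (simp add: var_def p x_def[symmetric] y_def[symmetric] coeff_poly_shift)
        (simp add: algebra_simps eq_neg_iff_add_eq_0)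
  qed
qed

text \<open>Compare the coefficients of y^(j+N): the quotient is \<open>w\<close> with its exponents
  of y lowered by \<open>N\<close>, terms of y-degree below \<open>N\<close> being dropped.\<close>

lemma var_power_dvd:
  fixes v w :: ring3
  assumes "var 1 ^ N * v = var 0 ^ N * w"
  shows "var 0 ^ N dvd v"
proof
  define x :: "complex poly" where "x = [:0, 1:] ^ N"
  have p: "[:t:] ^ N = [:t ^ N:]" for t :: "'b::comm_ring_1 poly"
    by (induction N) (auto simp: one_pCons)
  have 1: "var 1 ^ N = [:monom 1 N:]" by (simp add: var_def monom_altdef p)
  have 0: "var 0 ^ N = [:[:x:]:]" by (simp add: var_def p x_def)
  show "v = var 0 ^ N * map_poly (poly_shift N) w"
  proof (intro poly_eqI)
    fix k j i
    have "coeff (coeff (var 1 ^ N * v) k) (j + N) = coeff (coeff (var 0 ^ N * w) k) (j + N)"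
      unfolding assms ..
    then have "coeff (coeff v k) j = x * coeff (coeff w k) (j + N)"
      unfolding 0 1 by (simp add: coeff_monom_mult)
    then show "coeff (coeff (coeff v k) j) i = coeff (coeff (coeff (var 0 ^ N * map_poly (poly_shift N) w) k) j) i"
      unfolding 0 by (simp add: coeff_map_poly coeff_poly_shift)
  qed
qed

text \<open>The vanishing of \<open>H\<^sup>1(\<complex>\<^sup>3 - {0}, \<O>)\<close>, in the form: a section of the quotient by a free
  submodule that lifts after multiplication by a power of each coordinate lifts itself.\<close>

lemma lift_section:
  fixes M :: "('s \<Rightarrow> ring3) set" and g :: "nat \<Rightarrow> 's \<Rightarrow> ring3"
  assumes lin: "\<And>u v a b. u \<in> M \<Longrightarrow> v \<in> M \<Longrightarrow> (\<lambda>s. a * u s + b * v s) \<in> M"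
    and sat: "\<And>u a. a \<noteq> 0 \<Longrightarrow> (\<lambda>s. a * u s) \<in> M \<Longrightarrow> u \<in> M"
    and lam: "\<And>u v a b. lam (\<lambda>s. a * u s + b * v s) = a * lam u + b * lam v"
    and g: "\<And>j. j < k \<Longrightarrow> g j \<in> M" "\<And>j. j < k \<Longrightarrow> lam (g j) = 0"
    and span: "\<And>v. v \<in> M \<Longrightarrow> lam v = 0 \<Longrightarrow> \<exists>c. v = (\<lambda>s. \<Sum>j<k. c j * g j s)"
    and free: "\<And>c j. (\<And>s. (\<Sum>j<k. c j * g j s) = 0) \<Longrightarrow> j < k \<Longrightarrow> c j = 0"
    and v: "\<And>i. i < 3 \<Longrightarrow> \<exists>v\<in>M. lam v = var i ^ N * d"
  shows "\<exists>u\<in>M. lam u = d"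
proof -
  obtain v1 where v1: "v1 \<in> M" "lam v1 = var 0 ^ N * d" using v[of 0] by auto
  obtain v2 where v2: "v2 \<in> M" "lam v2 = var 1 ^ N * d" using v[of 1] by auto
  obtain v3 where v3: "v3 \<in> M" "lam v3 = var 2 ^ N * d" using v[of 2] by auto
  \<comment> \<open>\<open>v1\<close>, \<open>v2\<close>, \<open>v3\<close> divided by
    \<open>X\<close>, \<open>Y\<close>, \<open>Z\<close> lift \<open>d\<close> on the three charts
    where a coordinate is nonzero; the task is to make them agree.\<close>
  define X Y Z where "X = var 0 ^ N" and "Y = var 1 ^ N" and "Z = var 2 ^ N"
  have rel: "\<exists>c. \<forall>s. a * u s - b * w s = (\<Sum>j<k. c j * g j s)"
    if "u \<in> M" "w \<in> M" "a * lam u = b * lam w" for a b u w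
  proof -
    have "lam (\<lambda>s. a * u s + (- b) * w s) = 0" unfolding lam using that(3) by simp
    from span[OF lin[OF that(1,2)] this] show ?thesis by (simp add: fun_eq_iff)
  qed
  \<comment> \<open>The differences of two such lifts in the basis \<open>g\<close>, denominators
    cleared: a Cech 1-cochain.\<close>
  obtain c12 where c12: "\<And>s. Y * v1 s - X * v2 s = (\<Sum>j<k. c12 j * g j s)"
    using rel[of v1 v2 Y X] v1 v2 by (auto simp: X_def Y_def)
  obtain c13 where c13: "\<And>s. Z * v1 s - X * v3 s = (\<Sum>j<k. c13 j * g j s)"
    using rel[of v1 v3 Z X] v1 v3 by (auto simp: X_def Z_def)
  obtain c23 where c23: "\<And>s. Z * v2 s - Y * v3 s = (\<Sum>j<k. c23 j * g j s)"
    using rel[of v2 v3 Z Y] v2 v3 by (auto simp: Z_def Y_def)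
  have "\<exists>a b. c12 j = X * a + Y * b" if "j < k" for j
  proof -
    \<comment> \<open>The cocycle condition. As \<open>g\<close> is free it holds for each
      coefficient, and the Koszul relation then makes \<open>c12\<close> a coboundary.\<close>
    have "(\<Sum>j<k. (Z * c12 j + X * c23 j + Y * (- c13 j)) * g j s) = 0" for s
    proof -
      have "(\<Sum>j<k. (Z * c12 j + X * c23 j + Y * (- c13 j)) * g j s)
          = Z * (\<Sum>j<k. c12 j * g j s) + X * (\<Sum>j<k. c23 j * g j s) - Y * (\<Sum>j<k. c13 j * g j s)"
        by (simp add: sum_distrib_left algebra_simps sum.distrib sum_subtractf)
      also have "\<dots> = 0"
        unfolding c12[symmetric] c13[symmetric] c23[symmetric] by (simp add: algebra_simps)
      finally show ?thesis .
    qed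
    then have "Z * c12 j + X * c23 j + Y * (- c13 j) = 0" using free that by meson
    then show ?thesis unfolding X_def Y_def Z_def by (rule var_power_koszul)
  qed
  then obtain a b where ab: "\<And>j. j < k \<Longrightarrow> c12 j = X * a j + Y * b j" by metis
  have comb: "(\<lambda>s. \<Sum>j<k'. b j * g j s) \<in> M \<and> lam (\<lambda>s. \<Sum>j<k'. b j * g j s) = 0" if "k' \<le> k" for k'
    using that
  proof (induction k')
    case 0
    then show ?case using lin[OF v1(1) v1(1), of 0 0] lam[of 0 v1 0 v1] by simp
  next
    case (Suc k')
    then show ?case
      using lin[of "\<lambda>s. \<Sum>j<k'. b j * g j s" "g k'" 1 "b k'"]
        lam[of 1 "\<lambda>s. \<Sum>j<k'. b j * g j s" "b k'" "g k'"] g[of k'] by simp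
  qed
  \<comment> \<open>Correct the first lift by the part of the coboundary with factor
    \<open>Y\<close>; the result is divisible by \<open>X\<close>, so the denominator
    disappears.\<close>
  define v1' where "v1' = (\<lambda>s. v1 s - (\<Sum>j<k. b j * g j s))"
  have v1': "v1' \<in> M" "lam v1' = X * d"
    using lin[OF v1(1) conjunct1[OF comb[OF order.refl]], of 1 "-1"] comb[OF order.refl]
      lam[of 1 v1 "-1" "\<lambda>s. \<Sum>j<k. b j * g j s"] v1(2)
    by (simp_all add: v1'_def X_def)
  have "X dvd v1' s" for s
    unfolding X_def
  proof (rule var_power_dvd)
    have "Y * v1 s - X * v2 s = X * (\<Sum>j<k. a j * g j s) + Y * (\<Sum>j<k. b j * g j s)"
      unfolding c12 sum_distrib_left sum.distrib[symmetric]
      by (rule sum.cong) (simp_all add: ab algebra_simps)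
    then show "var 1 ^ N * v1' s = var 0 ^ N * (v2 s + (\<Sum>j<k. a j * g j s))"
      unfolding X_def[symmetric] Y_def[symmetric] v1'_def by (simp add: algebra_simps)
  qed
  then have "\<exists>u. \<forall>s. v1' s = X * u s" unfolding dvd_def by metis
  then obtain u where u: "v1' = (\<lambda>s. X * u s)" by (auto simp: fun_eq_iff)
  have X0: "X \<noteq> 0" by (simp add: X_def var_def)
  have "u \<in> M" using sat[OF X0] v1' u by simp
  moreover have "X * lam u = X * d" using v1'(2) lam[of X u 0 u] by (auto simp: u)
  ultimately show ?thesis using X0 by auto
qed

text \<open>After cancelling \<open>gcd a d\<close>, the remaining factor of \<open>a\<close>
  divides x/e for every \<open>x\<close> in \<open>S\<close>; as \<open>e\<close> is the greatest
  common divisor of \<open>S\<close>, this factor is a unit.\<close>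

lemma gcd_saturation:
  fixes a d e :: "'a::{factorial_ring_gcd, semiring_gcd_mult_normalize}"
  assumes e: "e = Gcd_factorial S" "e \<noteq> 0" and a: "a \<noteq> 0"
    and dvd: "\<And>x. x \<in> S \<Longrightarrow> a * e dvd d * x"
  shows "a dvd d"
proof -
  obtain a' d' where ad: "a = a' * gcd a d" "d = d' * gcd a d" "coprime a' d'"
    using gcd_coprime_exists[of a d] a by auto
  have "a' * e dvd e"
    unfolding e(1)
  proof (rule Gcd_factorial_greatest)
    fix x assume "x \<in> S"
    then have "e dvd x" unfolding e(1) by (rule Gcd_factorial_dvd)
    then obtain x' where x': "x = e * x'" by (auto simp: dvd_def)
    have "(gcd a d * e) * a' dvd (gcd a d * e) * (d' * x')"
      using dvd[OF \<open>x \<in> S\<close>] ad x' by (metis mult.assoc mult.commute)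
    then have "a' dvd d' * x'" using a e(2) by (subst (asm) dvd_mult_cancel_left) auto
    then have "a' dvd x'" using ad(3) by (simp add: coprime_dvd_mult_right_iff)
    then show "a' * Gcd_factorial S dvd x" using x' e(1) by (simp add: mult.commute mult_dvd_mono)
  qed
  then have "a' dvd 1" using e(2) dvd_mult_cancel_right[of a' e 1] by simp
  then have "a' * gcd a d dvd 1 * gcd a d" by (intro mult_dvd_mono) auto
  then show ?thesis using ad(1) by auto
qed

section \<open>Flags of modules given by local frames\<close>

lemma sum_mat_mult:
  fixes P Q :: "'a::comm_ring_1 mat"
  assumes "P \<in> carrier_mat n n" "Q \<in> carrier_mat n n" "i < n"
  shows "(\<Sum>s<n. (P * Q) $$ (i, s) * v s) = (\<Sum>j<n. P $$ (i, j) * (\<Sum>s<n. Q $$ (j, s) * v s))"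
proof -
  have "(\<Sum>s<n. (P * Q) $$ (i, s) * v s) = (\<Sum>s<n. \<Sum>j<n. P $$ (i, j) * (Q $$ (j, s) * v s))"
    using assms
    by (intro sum.cong) (auto simp: scalar_prod_def sum_distrib_right mult.assoc atLeast0LessThan)
  also have "\<dots> = (\<Sum>j<n. P $$ (i, j) * (\<Sum>s<n. Q $$ (j, s) * v s))"
    by (subst sum.swap) (simp add: sum_distrib_left)
  finally show ?thesis .
qed

lemma index_mult_mat_sum:
  assumes "P \<in> carrier_mat n n" "Q \<in> carrier_mat n n" "i < n" "j < n"
  shows "(P * Q) $$ (i, j) = (\<Sum>s<n. P $$ (i, s) * Q $$ (s, j))"
  using assms by (simp add: scalar_prod_def atLeast0LessThan)

text \<open>Each \<open>G\<close> is a frame adapted to the flag where its determinant is nonzero.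
  Up to the factor \<open>det G\<close>, \<open>adj_mat G * G'\<close> is the transition matrix, so
  \<open>compatible\<close> says that the first k columns span the same space over the fraction
  field, for every k.\<close>

locale rational_flag =
  fixes n :: nat and \<G> :: "ring3 mat set" and G0 :: "ring3 mat"
  assumes carrier: "G \<in> \<G> \<Longrightarrow> G \<in> carrier_mat n n" "G \<in> \<G> \<Longrightarrow> det G \<noteq> 0"
    and compatible: "G \<in> \<G> \<Longrightarrow> G' \<in> \<G> \<Longrightarrow> j < i \<Longrightarrow> i < n \<Longrightarrow> (adj_mat G * G') $$ (i, j) = 0"
    and cover: "\<exists>i<3. w i \<noteq> 0 \<Longrightarrow> \<exists>G\<in>\<G>. ev w (det G) \<noteq> 0"
    and G0: "G0 \<in> \<G>"
begin

text \<open>By Cramer's rule, \<open>det G\<close> times the i-th coordinate of \<open>v\<close> in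
  the basis of columns of \<open>G\<close>.\<close>

definition comp :: "ring3 mat \<Rightarrow> nat \<Rightarrow> (nat \<Rightarrow> ring3) \<Rightarrow> ring3" where
  "comp G i v = (\<Sum>s<n. adj_mat G $$ (i, s) * v s)"

text \<open>Polynomial sections of the k-th step of the flag: the span of the first \<open>k\<close>
  columns of \<open>G0\<close> over the fraction field, intersected with the polynomial vectors.
  Padding with zeros lets vectors be compared as functions.\<close>

definition M :: "nat \<Rightarrow> (nat \<Rightarrow> ring3) set" where
  "M k = {v. (\<forall>s\<ge>n. v s = 0) \<and> (\<forall>i. k \<le> i \<and> i < n \<longrightarrow> comp G0 i v = 0)}"

definition column :: "ring3 mat \<Rightarrow> nat \<Rightarrow> nat \<Rightarrow> ring3" where
  "column G j s = (if s < n then G $$ (s, j) else 0)"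

lemma comp_linear: "comp G i (\<lambda>s. a * u s + b * v s) = a * comp G i u + b * comp G i v"
  by (simp add: comp_def sum.distrib sum_distrib_left algebra_simps)

lemma comp_smult: "comp G i (\<lambda>s. a * u s) = a * comp G i u"
  using comp_linear[of G i a u 0 u] by simp

lemma comp_column:
  assumes "G \<in> \<G>" "G' \<in> \<G>" "i < n" "j < n"
  shows "comp G i (column G' j) = (adj_mat G * G') $$ (i, j)"
  using assms carrier adj_mat(1)[OF carrier(1)]
  by (auto simp: comp_def column_def index_mult_mat_sum[where n = n])

lemma M_linear: "u \<in> M k \<Longrightarrow> v \<in> M k \<Longrightarrow> (\<lambda>s. a * u s + b * v s) \<in> M k"
  by (auto simp: M_def comp_linear)

lemma M_saturated: "a \<noteq> 0 \<Longrightarrow> (\<lambda>s. a * u s) \<in> M k \<Longrightarrow> u \<in> M k"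
  by (auto simp: M_def comp_smult)

lemma M_mono: "k \<le> l \<Longrightarrow> M k \<subseteq> M l"
  by (auto simp: M_def)

lemma M_Suc: "k < n \<Longrightarrow> v \<in> M k \<longleftrightarrow> v \<in> M (Suc k) \<and> comp G0 k v = 0"
  by (auto simp: M_def) (metis not_less_eq_eq le_antisym)

lemma column_in_M: "G \<in> \<G> \<Longrightarrow> j < k \<Longrightarrow> k \<le> n \<Longrightarrow> column G j \<in> M k"
  using comp_column[OF G0] compatible[OF G0] by (auto simp: M_def column_def)

text \<open>Change of frame, from \<open>adj_mat G' * G * adj_mat G = det G \<cdot>\<^sub>m adj_mat
  G'\<close>.\<close>

lemma det_mult_comp:
  assumes "G \<in> \<G>" "G' \<in> \<G>" "i < n"
  shows "det G * comp G' i v = (\<Sum>j<n. (adj_mat G' * G) $$ (i, j) * comp G j v)"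
proof -
  note G = carrier(1)[OF assms(1)] carrier(1)[OF assms(2)]
  have "adj_mat G' * G * adj_mat G = adj_mat G' * (G * adj_mat G)"
    using G adj_mat(1) by (intro assoc_mult_mat[of _ n n _ n _ n]) auto
  also have "\<dots> = det G \<cdot>\<^sub>m adj_mat G'"
    using mult_smult_distrib[OF adj_mat(1)[OF G(2)] one_carrier_mat] adj_mat(1)[OF G(2)]
    by (simp add: adj_mat(2)[OF G(1)])
  finally have eq: "adj_mat G' * G * adj_mat G = det G \<cdot>\<^sub>m adj_mat G'" .
  have "(\<Sum>j<n. (adj_mat G' * G) $$ (i, j) * comp G j v)
      = (\<Sum>s<n. (adj_mat G' * G * adj_mat G) $$ (i, s) * v s)"
    unfolding comp_def using G adj_mat(1)[OF G(1)] adj_mat(1)[OF G(2)] assms(3)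
    by (intro sum_mat_mult[symmetric] mult_carrier_mat[of _ n n]) auto
  also have "\<dots> = det G * comp G' i v"
    using adj_mat(1)[OF G(2)] assms(3) unfolding eq comp_def
    by (simp add: sum_distrib_left mult.assoc)
  finally show ?thesis by simp
qed

text \<open>The transition matrix to \<open>G0\<close> is triangular, so the equations that define
  \<open>M k\<close> through \<open>G0\<close> pass to every frame.\<close>

lemma comp_eq_0:
  assumes "G \<in> \<G>" "v \<in> M k" "k \<le> i" "i < n"
  shows "comp G i v = 0"
proof -
  have "det G0 * comp G i v = (\<Sum>j<n. (adj_mat G * G0) $$ (i, j) * comp G0 j v)"
    by (rule det_mult_comp[OF G0 assms(1,4)])
  also have "\<dots> = 0"
  proof (intro sum.neutral ballI)
    fix j assume "j \<in> {..<n}"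
    then show "(adj_mat G * G0) $$ (i, j) * comp G0 j v = 0"
      using assms compatible[OF assms(1) G0, of j i] by (cases "j < i") (auto simp: M_def)
  qed
  finally show ?thesis using carrier(2)[OF G0] by simp
qed

text \<open>The transition rule of the line bundle given by one step of the flag modulo the previous
  one: triangularity kills the terms below \<open>k\<close>, membership in \<open>M (Suc k)\<close>
  those above, and one diagonal entry remains.\<close>

lemma det_mult_comp_top:
  assumes "G \<in> \<G>" "v \<in> M (Suc k)" "k < n"
  shows "det G * comp G0 k v = comp G0 k (column G k) * comp G k v"
proof -
  have "det G * comp G0 k v = (\<Sum>j<n. (adj_mat G0 * G) $$ (k, j) * comp G j v)"
    by (rule det_mult_comp[OF assms(1) G0 assms(3)])
  also have "\<dots> = (\<Sum>j\<in>{k}. (adj_mat G0 * G) $$ (k, j) * comp G j v)"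
  proof (intro sum.mono_neutral_right ballI)
    fix j assume "j \<in> {..<n} - {k}"
    then show "(adj_mat G0 * G) $$ (k, j) * comp G j v = 0"
      using assms compatible[OF G0 assms(1), of j k] comp_eq_0[OF assms(1,2), of j]
      by (cases "j < k") auto
  qed (use assms in auto)
  finally show ?thesis using comp_column[OF G0 assms(1,3,3)] by simp
qed

text \<open>The map \<open>comp G0 k\<close> embeds \<open>M (Suc k)\<close> modulo
  \<open>M k\<close> into the polynomials as an ideal, and the claim is that this ideal is
  principal. Unique factorisation provides the greatest common divisor; \<open>lift_section\<close>
  shows that it is attained, as \<open>M k\<close> is free.\<close>

lemma ex_generator:
  assumes k: "k < n"
    and g: "\<And>j. j < k \<Longrightarrow> g j \<in> M k"
    and span: "\<And>v. v \<in> M k \<Longrightarrow> \<exists>c. v = (\<lambda>s. \<Sum>j<k. c j * g j s)"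
    and free: "\<And>c j. (\<And>s. (\<Sum>j<k. c j * g j s) = 0) \<Longrightarrow> j < k \<Longrightarrow> c j = 0"
  shows "\<exists>u\<in>M (Suc k). comp G0 k u \<noteq> 0 \<and> (\<forall>v\<in>M (Suc k). comp G0 k u dvd comp G0 k v)"
proof -
  define S where "S = comp G0 k ` M (Suc k)"
  define e where "e = Gcd_factorial S"
  have colS: "comp G0 k (column G k) \<in> S" if "G \<in> \<G>" for G
    using column_in_M[OF that, of k "Suc k"] k by (auto simp: S_def)
  have "comp G0 k (column G0 k) = det G0"
    using k carrier(1)[OF G0] by (simp add: comp_column[OF G0 G0 k k] adj_mat(3))
  then have e0: "e \<noteq> 0"
    using colS[OF G0] carrier(2)[OF G0] by (auto simp: e_def Gcd_factorial_eq_0_iff)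
  have e_dvd: "e dvd x" if "x \<in> S" for x
    unfolding e_def using that by (rule Gcd_factorial_dvd)
  \<comment> \<open>So \<open>S\<close> equals \<open>e\<close> times \<open>J\<close>, and
    triviality of the line bundle off the origin amounts to \<open>J\<close> having no zero
    there.\<close>
  define J where "J = {r. r * e \<in> S}"
  have "is_ideal J"
    unfolding is_ideal_def J_def S_def
  proof (intro conjI ballI allI CollectI)
    have z: "(\<lambda>s. 0) \<in> M (Suc k)" by (auto simp: M_def comp_def)
    show "0 * e \<in> comp G0 k ` M (Suc k)" using z by (intro image_eqI[of _ _ "\<lambda>s. 0"]) (auto simp: comp_def)
    fix a assume "a \<in> {r. r * e \<in> comp G0 k ` M (Suc k)}"
    then obtain u where u: "u \<in> M (Suc k)" "comp G0 k u = a * e" by force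
    show "r * a * e \<in> comp G0 k ` M (Suc k)" for r
      using M_linear[OF u(1) u(1), of r 0] u(2)
      by (intro image_eqI[of _ _ "\<lambda>s. r * u s + 0 * u s"]) (auto simp: comp_smult)
    fix b assume "b \<in> {r. r * e \<in> comp G0 k ` M (Suc k)}"
    then obtain v where v: "v \<in> M (Suc k)" "comp G0 k v = b * e" by force
    show "(a + b) * e \<in> comp G0 k ` M (Suc k)"
      using M_linear[OF u(1) v(1), of 1 1] u(2) v(2) comp_linear[of G0 k 1 u 1 v]
      by (intro image_eqI[of _ _ "\<lambda>s. 1 * u s + 1 * v s"]) (auto simp: algebra_simps)
  qed
  moreover have "\<exists>p\<in>J. ev w p \<noteq> 0" if w: "\<exists>i<3. w i \<noteq> 0" for w
  proof -
    obtain G where G: "G \<in> \<G>" "ev w (det G) \<noteq> 0" using cover[OF w] by blast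
    obtain a where a: "comp G0 k (column G k) = a * e"
      using e_dvd[OF colS[OF G(1)]] by (auto simp: dvd_def mult.commute)
    \<comment> \<open>The transition rule makes \<open>a * e\<close> divide \<open>det G\<close>
      times every element of \<open>S\<close>; then \<open>a\<close> divides \<open>det G\<close>,
      so it is nonzero at \<open>w\<close>.\<close>
    have *: "a * e dvd det G * x" if "x \<in> S" for x
      using that det_mult_comp_top[OF G(1) _ k] a by (auto simp: S_def)
    have "a \<noteq> 0"
    proof
      assume "a = 0"
      then have "det G * comp G0 k (column G0 k) = 0" using *[OF colS[OF G0]] by simp
      then show False using carrier(2) G(1) G0 \<open>comp G0 k (column G0 k) = det G0\<close> by auto
    qed
    then have "a dvd det G" by (rule gcd_saturation[OF e_def e0 _ *])
    then have "ev w a \<noteq> 0" using G(2) by (auto simp: dvd_def ev.hom_mult)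
    moreover have "a \<in> J" using a colS[OF G(1)] by (simp add: J_def)
    ultimately show ?thesis by blast
  qed
  ultimately have "\<exists>N. var i ^ N \<in> J" if "i < 3" for i
    using that by (rule var_power_in_ideal)
  then obtain N where N: "\<And>i. i < 3 \<Longrightarrow> var i ^ N i \<in> J" by metis
  \<comment> \<open>A common exponent for the three variables: the sum bounds each
    \<open>N i\<close>.\<close>
  have "var i ^ (N 0 + N 1 + N 2) \<in> J" if "i < 3" for i
  proof -
    have "N i \<le> N 0 + N 1 + N 2" using that by (auto simp: numeral_3_eq_3 numeral_2_eq_2 less_Suc_eq)
    then have "var i ^ (N 0 + N 1 + N 2) = var i ^ (N 0 + N 1 + N 2 - N i) * var i ^ N i"
      by (simp flip: power_add)
    then show ?thesis using N[OF that] \<open>is_ideal J\<close> by (simp add: is_ideal_def)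
  qed
  then have "\<exists>v\<in>M (Suc k). comp G0 k v = var i ^ (N 0 + N 1 + N 2) * e" if "i < 3" for i
    using that by (force simp: J_def S_def)
  note lift = this
  have "\<exists>u\<in>M (Suc k). comp G0 k u = e"
  proof (rule lift_section[where g = g and k = k])
    show "(\<lambda>s. a * u s + b * v s) \<in> M (Suc k)" if "u \<in> M (Suc k)" "v \<in> M (Suc k)" for u v a b
      using that by (rule M_linear)
    show "u \<in> M (Suc k)" if "a \<noteq> 0" "(\<lambda>s. a * u s) \<in> M (Suc k)" for u a
      using that by (rule M_saturated)
    show "comp G0 k (\<lambda>s. a * u s + b * v s) = a * comp G0 k u + b * comp G0 k v" for u v a b
      by (rule comp_linear)
    show "g j \<in> M (Suc k)" "comp G0 k (g j) = 0" if "j < k" for j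
      using g[OF that] M_Suc[OF k] by blast+
    show "\<exists>c. v = (\<lambda>s. \<Sum>j<k. c j * g j s)" if "v \<in> M (Suc k)" "comp G0 k v = 0" for v
      using span that M_Suc[OF k] by blast
    show "c j = 0" if "\<And>s. (\<Sum>j<k. c j * g j s) = 0" "j < k" for c j
      using that by (rule free)
    show "\<exists>v\<in>M (Suc k). comp G0 k v = var i ^ (N 0 + N 1 + N 2) * e" if "i < 3" for i
      using that by (rule lift)
  qed
  then show ?thesis using e0 e_dvd by (auto simp: S_def)
qed

text \<open>The induction carries spanning for every \<open>l \<le> k\<close>, not just for
  \<open>k\<close>, because the final basis must be adapted to the whole flag.\<close>

lemma ex_basis:
  assumes "k \<le> n"
  shows "\<exists>g. (\<forall>j<k. g j \<in> M (Suc j)) \<and>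
    (\<forall>l\<le>k. \<forall>v\<in>M l. \<exists>c. v = (\<lambda>s. \<Sum>j<l. c j * g j s)) \<and>
    (\<forall>c. (\<forall>s. (\<Sum>j<k. c j * g j s) = 0) \<longrightarrow> (\<forall>j<k. c j = 0))"
  using assms
proof (induction k)
  case 0
  \<comment> \<open>All coordinates with respect to \<open>G0\<close> vanish, and \<open>G0\<close>
    is invertible over the fraction field.\<close>
  have "v s = 0" if "v \<in> M 0" for v s
  proof (cases "s < n")
    case True
    have "det G0 * v s = (\<Sum>j\<in>{s}. (G0 * adj_mat G0) $$ (s, j) * v j)"
      using True carrier(1)[OF G0] by (simp add: adj_mat(2))
    also have "\<dots> = (\<Sum>j<n. (G0 * adj_mat G0) $$ (s, j) * v j)"
      using True carrier(1)[OF G0] by (intro sum.mono_neutral_left) (auto simp: adj_mat(2))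
    also have "\<dots> = (\<Sum>j<n. G0 $$ (s, j) * comp G0 j v)"
      unfolding comp_def using True carrier(1)[OF G0] adj_mat(1) by (intro sum_mat_mult) auto
    also have "\<dots> = 0" using that by (simp add: M_def)
    finally show ?thesis using carrier(2)[OF G0] by simp
  qed (use that in \<open>auto simp: M_def\<close>)
  then show ?case by auto
next
  case (Suc k)
  then have k: "k < n" by simp
  obtain g where gs: "\<forall>j<k. g j \<in> M (Suc j)"
    "\<forall>l\<le>k. \<forall>v\<in>M l. \<exists>c. v = (\<lambda>s. \<Sum>j<l. c j * g j s)"
    "\<forall>c. (\<forall>s. (\<Sum>j<k. c j * g j s) = 0) \<longrightarrow> (\<forall>j<k. c j = 0)"
    using Suc.IH[OF less_imp_le[OF k]] by (elim exE conjE)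
  have g: "g j \<in> M (Suc j)" if "j < k" for j
    using gs(1) that by simp
  have span: "\<exists>c. v = (\<lambda>s. \<Sum>j<l. c j * g j s)" if "l \<le> k" "v \<in> M l" for l v
    using gs(2) that by simp
  have free: "c j = 0" if "\<And>s. (\<Sum>j<k. c j * g j s) = 0" "j < k" for c j
    using gs(3) that by simp
  have gk: "g j \<in> M k" if "j < k" for j
    using g[OF that] M_mono[of "Suc j" k] that by auto
  obtain u where u: "u \<in> M (Suc k)" "comp G0 k u \<noteq> 0"
    and dvd: "\<And>v. v \<in> M (Suc k) \<Longrightarrow> comp G0 k u dvd comp G0 k v"
  proof -
    have "\<exists>u\<in>M (Suc k). comp G0 k u \<noteq> 0 \<and> (\<forall>v\<in>M (Suc k). comp G0 k u dvd comp G0 k v)"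
    proof (rule ex_generator[OF k, where g = g])
      show "\<exists>c. v = (\<lambda>s. \<Sum>j<k. c j * g j s)" if "v \<in> M k" for v
        using span[OF order.refl that] .
      show "c j = 0" if "\<And>s. (\<Sum>j<k. c j * g j s) = 0" "j < k" for c j
        using that by (rule free)
    qed (rule gk)
    then show thesis using that by blast
  qed
  define h where "h = g(k := u)"
  have h: "(\<Sum>j<l. c j * h j s) = (\<Sum>j<l. c j * g j s)" if "l \<le> k" for l c s
    using that by (intro sum.cong) (auto simp: h_def)
  have "\<exists>c. v = (\<lambda>s. \<Sum>j<l. c j * h j s)" if "l \<le> Suc k" "v \<in> M l" for l v
  proof (cases "l = Suc k")
    case False
    then show ?thesis using span[of l v] that h by simp
  next
    case True
    then obtain r where r: "comp G0 k v = comp G0 k u * r" using dvd \<open>v \<in> M l\<close> by (auto simp: dvd_def)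
    \<comment> \<open>Subtracting this multiple of the new generator kills the top coordinate and
      lands in \<open>M k\<close>.\<close>
    have "(\<lambda>s. 1 * v s + (- r) * u s) \<in> M k"
    proof (rule iffD2[OF M_Suc[OF k]], rule conjI)
      show "(\<lambda>s. 1 * v s + (- r) * u s) \<in> M (Suc k)"
        using that(2) u(1) unfolding True by (rule M_linear)
      show "comp G0 k (\<lambda>s. 1 * v s + (- r) * u s) = 0"
        unfolding comp_linear r by simp
    qed
    then obtain c where "(\<lambda>s. 1 * v s + (- r) * u s) = (\<lambda>s. \<Sum>j<k. c j * g j s)"
      using span[OF order.refl] by blast
    then have c: "v s = (\<Sum>j<k. c j * g j s) + r * u s" for s
      by (simp add: fun_eq_iff algebra_simps)
    show ?thesis
    proof (intro exI ext)
      fix s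
      have "(\<Sum>j<k. c j * g j s) = (\<Sum>j<k. (c(k := r)) j * h j s)"
        by (intro sum.cong) (auto simp: h_def)
      then show "v s = (\<Sum>j<l. (c(k := r)) j * h j s)"
        unfolding c True by (simp add: h_def)
    qed
  qed
  moreover have "c j = 0" if c: "\<And>s. (\<Sum>j<Suc k. c j * h j s) = 0" and "j < Suc k" for c j
  proof -
    have c': "(\<Sum>j<k. c j * g j s) + c k * u s = 0" for s
      using c[of s] by (simp add: h h_def)
    \<comment> \<open>Applying \<open>comp G0 k\<close>, which vanishes on \<open>M k\<close>,
      isolates the coefficient of \<open>u\<close>.\<close>
    have "(\<lambda>s. - (c k) * u s) = (\<lambda>s. \<Sum>j<k. c j * g j s)"
      using c' by (auto simp: fun_eq_iff add_eq_0_iff2 algebra_simps)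
    moreover have "comp G0 k (\<lambda>s. \<Sum>j<k. c j * g j s) = (\<Sum>j<k. c j * comp G0 k (g j))"
      unfolding comp_def sum_distrib_left by (subst sum.swap) (simp add: mult_ac)
    moreover have "\<dots> = 0" using gk M_Suc[OF k] by simp
    ultimately have "comp G0 k (\<lambda>s. - (c k) * u s) = 0" by simp
    then have ck: "c k = 0" using u(2) unfolding comp_smult by simp
    then have "c j = 0" if "j < k" using free[of c j] c' that by simp
    then show ?thesis using ck \<open>j < Suc k\<close> by (auto simp: less_Suc_eq)
  qed
  moreover have "\<forall>j<Suc k. h j \<in> M (Suc j)" using g u(1) by (auto simp: h_def less_Suc_eq)
  ultimately show ?case by (intro exI[of _ h] conjI allI impI ballI) simp_all
qed

text \<open>\<open>M n\<close> consists of all polynomial vectors, so the matrix of the adapted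
  basis is invertible over the polynomials, also at the origin. Frames expand in it with triangular
  coefficients, because column l lies in \<open>M (Suc l)\<close>.\<close>

lemma flag_trivial:
  "\<exists>g\<in>carrier_mat n n. \<exists>C\<in>carrier_mat n n. g * C = 1\<^sub>m n \<and> C * g = 1\<^sub>m n \<and>
     (\<forall>G\<in>\<G>. \<forall>i<n. \<forall>j<i. (C * G) $$ (i, j) = 0)"
proof -
  obtain g where gs: "\<forall>j<n. g j \<in> M (Suc j)"
    "\<forall>l\<le>n. \<forall>v\<in>M l. \<exists>c. v = (\<lambda>s. \<Sum>j<l. c j * g j s)"
    "\<forall>c. (\<forall>s. (\<Sum>j<n. c j * g j s) = 0) \<longrightarrow> (\<forall>j<n. c j = 0)"
    using ex_basis[OF order.refl] by (elim exE conjE)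
  have gM: "g j \<in> M (Suc j)" if "j < n" for j
    using gs(1) that by simp
  have span: "\<exists>c. v = (\<lambda>s. \<Sum>j<l. c j * g j s)" if "l \<le> n" "v \<in> M l" for l v
    using gs(2) that by simp
  have free: "c j = 0" if "\<And>s. (\<Sum>j<n. c j * g j s) = 0" "j < n" for c j
    using gs(3) that by simp
  have "\<exists>c. (\<lambda>s. if s = i then 1 else 0) = (\<lambda>s. \<Sum>j<n. c j * g j s)" if "i < n" for i
    using that by (intro span) (auto simp: M_def)
  then obtain c where c: "\<And>i. i < n \<Longrightarrow> (\<lambda>s. if s = i then 1 else 0) = (\<lambda>s. \<Sum>j<n. c i j * g j s)"
    by metis
  define A C where "A = mat n n (\<lambda>(s, j). g j s)" and "C = mat n n (\<lambda>(j, i). c i j)"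
  have carr [simp]: "A \<in> carrier_mat n n" "C \<in> carrier_mat n n" by (auto simp: A_def C_def)
  have idx: "(A * B) $$ (s, i) = (\<Sum>j<n. B $$ (j, i) * g j s)"
    if "B \<in> carrier_mat n n" "s < n" "i < n" for B s i
    using that carr index_mult_mat_sum[of A n B s i] by (simp add: A_def mult.commute)
  have AC: "A * C = 1\<^sub>m n"
  proof (rule eq_matI)
    fix s i assume "s < dim_row (1\<^sub>m n :: ring3 mat)" "i < dim_col (1\<^sub>m n :: ring3 mat)"
    then have si: "s < n" "i < n" by auto
    have "(A * C) $$ (s, i) = (\<Sum>j<n. c i j * g j s)"
      using si by (subst idx) (auto simp: C_def)
    then show "(A * C) $$ (s, i) = 1\<^sub>m n $$ (s, i)" using si fun_cong[OF c[of i], of s] by auto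
  qed (use carrier_matD[OF carr(1)] carrier_matD[OF carr(2)] in auto)
  \<comment> \<open>Freeness makes left multiplication by \<open>A\<close> injective, which turns
    the right inverse into a two-sided one.\<close>
  have cancel: "X = Y" if XY: "X \<in> carrier_mat n n" "Y \<in> carrier_mat n n" "A * X = A * Y" for X Y
  proof (rule eq_matI)
    fix j i assume "j < dim_row Y" "i < dim_col Y"
    then have ji: "j < n" "i < n" using XY by auto
    have "(\<Sum>j<n. (X $$ (j, i) - Y $$ (j, i)) * g j s) = 0" for s
    proof (cases "s < n")
      case True
      have "(A * X) $$ (s, i) = (A * Y) $$ (s, i)" using XY by simp
      then show ?thesis using idx[OF XY(1) True ji(2)] idx[OF XY(2) True ji(2)]
        by (simp add: left_diff_distrib sum_subtractf)
    next
      case False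
      then show ?thesis using gM by (auto simp: M_def)
    qed
    from free[OF this ji(1)] show "X $$ (j, i) = Y $$ (j, i)" by simp
  qed (use XY in auto)
  have CA: "C * A = 1\<^sub>m n"
  proof (rule cancel)
    show "A * (C * A) = A * 1\<^sub>m n"
      using assoc_mult_mat[OF carr(1) carr(2) carr(1)]
      unfolding AC left_mult_one_mat[OF carr(1)] right_mult_one_mat[OF carr(1)] by simp
  qed (auto intro: mult_carrier_mat[OF carr(2) carr(1)])
  have "(C * G) $$ (i, j) = 0" if G: "G \<in> \<G>" and ij: "i < n" "j < i" for G i j
  proof -
    note Gc = carrier(1)[OF G]
    have "\<exists>c. column G l = (\<lambda>s. \<Sum>j<Suc l. c j * g j s)" if "l < n" for l
      using that by (intro span column_in_M[OF G]) auto
    then obtain b where b: "\<And>l. l < n \<Longrightarrow> column G l = (\<lambda>s. \<Sum>j<Suc l. b l j * g j s)" by metis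
    define U where "U = mat n n (\<lambda>(j, l). if j \<le> l then b l j else 0)"
    have Uc [simp]: "U \<in> carrier_mat n n" by (simp add: U_def)
    have "G = A * U"
    proof (rule eq_matI)
      fix s l assume "s < dim_row (A * U)" "l < dim_col (A * U)"
      then have sl: "s < n" "l < n" by (auto simp: A_def U_def)
      have "(A * U) $$ (s, l) = (\<Sum>j<n. (if j \<le> l then b l j else 0) * g j s)"
        using sl by (subst idx) (auto simp: U_def)
      also have "\<dots> = (\<Sum>j<Suc l. b l j * g j s)"
        using sl by (intro sum.mono_neutral_cong_right) auto
      also have "\<dots> = G $$ (s, l)" using fun_cong[OF b[of l], of s] sl by (simp add: column_def)
      finally show "G $$ (s, l) = (A * U) $$ (s, l)" by simp
    qed (use Gc in \<open>auto simp: A_def U_def\<close>)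
    then have "C * G = (C * A) * U" using assoc_mult_mat[of C n n A n U n] by simp
    then have "C * G = U" unfolding CA left_mult_one_mat[OF Uc] .
    then show ?thesis using ij by (simp add: U_def)
  qed
  then show ?thesis using AC CA carr by blast
qed

end

section \<open>Scaling-invariant flags\<close>

lemma upper_triangular_mult:
  fixes A B :: "'a::comm_ring_1 mat"
  assumes A: "A \<in> carrier_mat n n" "upper_triangular A" and B: "B \<in> carrier_mat n n" "upper_triangular B"
  shows "upper_triangular (A * B)"
proof (rule upper_triangularI)
  fix i j assume "j < i" "i < dim_row (A * B)"
  then have ij: "j < i" "i < n" using A by auto
  have "(A * B) $$ (i, j) = (\<Sum>s<n. A $$ (i, s) * B $$ (s, j))"
    using A B ij by (intro index_mult_mat_sum) auto
  also have "\<dots> = 0"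
  proof (intro sum.neutral ballI)
    fix s assume "s \<in> {..<n}"
    then show "A $$ (i, s) * B $$ (s, j) = 0"
      using A B ij upper_triangularD[of A s i] upper_triangularD[of B j s] by (cases "s < i") auto
  qed
  finally show "(A * B) $$ (i, j) = 0" .
qed

text \<open>Work through the columns from the left: earlier entries of the row vanish by induction,
  later ones meet zeros of \<open>U\<close>, and the diagonal entries of \<open>U\<close> are
  nonzero because its determinant is.\<close>

lemma upper_triangular_cancel_right:
  fixes Y U :: "'a::idom mat"
  assumes Y: "Y \<in> carrier_mat n n" and U: "U \<in> carrier_mat n n" "upper_triangular U" "det U \<noteq> 0"
    and YU: "upper_triangular (Y * U)"
  shows "upper_triangular Y"
proof (rule upper_triangularI)
  fix i j assume "j < i" "i < dim_row Y"
  then have i: "i < n" and "j < i" using Y by auto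
  from \<open>j < i\<close> show "Y $$ (i, j) = 0"
  proof (induction j rule: less_induct)
    case (less j)
    then have j: "j < n" using i by simp
    have "0 = (Y * U) $$ (i, j)" using less.prems YU Y i by (intro upper_triangularD[symmetric]) auto
    also have "\<dots> = (\<Sum>s<n. Y $$ (i, s) * U $$ (s, j))"
      using Y U i j by (intro index_mult_mat_sum) auto
    also have "\<dots> = (\<Sum>s\<in>{j}. Y $$ (i, s) * U $$ (s, j))"
    proof (intro sum.mono_neutral_right ballI)
      fix s assume "s \<in> {..<n} - {j}"
      then show "Y $$ (i, s) * U $$ (s, j) = 0"
        using less U upper_triangularD[of U j s] by (cases "s < j") auto
    qed (use j in auto)
    finally have "Y $$ (i, j) * U $$ (j, j) = 0" by simp
    moreover have "U $$ (j, j) \<noteq> 0"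
      using U j unfolding det_upper_triangular[OF U(2,1)] by (auto simp: diag_mat_def prod_list_zero_iff)
    ultimately show ?case by simp
  qed
qed

lemma upper_triangular_adj_mat:
  fixes U :: "'a::idom mat"
  assumes U: "U \<in> carrier_mat n n" "upper_triangular U" "det U \<noteq> 0"
  shows "upper_triangular (adj_mat U)"
proof (rule upper_triangular_cancel_right[OF adj_mat(1)[OF U(1)] U])
  show "upper_triangular (adj_mat U * U)"
    unfolding adj_mat(3)[OF U(1)] by (rule upper_triangularI) auto
qed

lemma adj_mat_mult_mult:
  fixes A X :: "'a::comm_ring_1 mat"
  assumes A: "A \<in> carrier_mat n n" and X: "X \<in> carrier_mat n m"
  shows "adj_mat A * (A * X) = det A \<cdot>\<^sub>m X"
proof -
  have "adj_mat A * (A * X) = adj_mat A * A * X"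
    by (rule assoc_mult_mat[symmetric, OF adj_mat(1)[OF A] A X])
  also have "\<dots> = det A \<cdot>\<^sub>m X"
    unfolding adj_mat(3)[OF A] mult_smult_assoc_mat[OF one_carrier_mat X] left_mult_one_mat[OF X] ..
  finally show ?thesis .
qed

lemma mat_cancel_left:
  fixes A P Q :: "'a::idom mat"
  assumes A: "A \<in> carrier_mat n n" "det A \<noteq> 0" and P: "P \<in> carrier_mat n m" and Q: "Q \<in> carrier_mat n m"
    and eq: "A * P = A * Q"
  shows "P = Q"
proof (rule eq_matI)
  fix i j assume "i < dim_row Q" "j < dim_col Q"
  moreover have "det A \<cdot>\<^sub>m P = det A \<cdot>\<^sub>m Q"
    using eq adj_mat_mult_mult[OF A(1) P] adj_mat_mult_mult[OF A(1) Q] by simp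
  then have "(det A \<cdot>\<^sub>m P) $$ (i, j) = (det A \<cdot>\<^sub>m Q) $$ (i, j)" by simp
  ultimately show "P $$ (i, j) = Q $$ (i, j)" using A P Q by simp
qed (use P Q in auto)

lemma upper_triangular_cancel_left:
  fixes X U :: "'a::idom mat"
  assumes X: "X \<in> carrier_mat n n" and U: "U \<in> carrier_mat n n" "upper_triangular U" "det U \<noteq> 0"
    and UX: "upper_triangular (U * X)"
  shows "upper_triangular X"
proof (rule upper_triangularI)
  fix i j assume ij: "j < i" "i < dim_row X"
  have "upper_triangular (adj_mat U * (U * X))"
    by (rule upper_triangular_mult[OF adj_mat(1)[OF U(1)] upper_triangular_adj_mat[OF U]
          mult_carrier_mat[OF U(1) X] UX])
  then have "upper_triangular (det U \<cdot>\<^sub>m X)"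
    unfolding adj_mat_mult_mult[OF U(1) X] .
  then have "(det U \<cdot>\<^sub>m X) $$ (i, j) = 0" using ij by (intro upper_triangularD) auto
  then show "X $$ (i, j) = 0" using U(3) X ij by simp
qed

text \<open>On the line through the origin and \<open>w\<close> a polynomial is one in
  \<open>t\<close>; the limit t to 0 thus becomes an argument about polynomials with infinitely many
  roots.\<close>

lemma ev_scaled_poly: "\<exists>q. \<forall>t. ev (\<lambda>i. t * w i) p = poly q t"
proof -
  have 2: "\<exists>q. \<forall>t. poly (poly a [:t * w 1:]) (t * w 0) = poly q t" for a :: "complex poly poly"
  proof (induction a)
    case 0
    then show ?case by (intro exI[of _ 0]) simp
  next
    case (pCons c a)
    then obtain q where "\<forall>t. poly (poly a [:t * w 1:]) (t * w 0) = poly q t" by blast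
    then show ?case
      by (intro exI[of _ "pcompose c [:0, w 0:] + [:0, w 1:] * q"]) (simp add: poly_pcompose)
  qed
  show ?thesis
    unfolding ev_def
  proof (induction p)
    case 0
    then show ?case by (intro exI[of _ 0]) simp
  next
    case (pCons c p)
    then obtain q where q: "\<forall>t. poly (poly (poly p [:[:t * w 2:]:]) [:t * w 1:]) (t * w 0) = poly q t"
      by blast
    obtain r where "\<forall>t. poly (poly c [:t * w 1:]) (t * w 0) = poly r t" using 2 by blast
    with q show ?case
      by (intro exI[of _ "r + [:0, w 2:] * q"]) simp
  qed
qed

text \<open>\<open>g0 w\<close> represents the value at \<open>w\<close> of a map to \<open>G/B\<close>, and \<open>U\<close> is the change of representative
  to a local polynomial lift of that map.\<close>

lemma homogeneous_flag_constant:
  fixes g0 :: "(nat \<Rightarrow> complex) \<Rightarrow> complex mat"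
  assumes g0: "\<And>w. \<exists>i<3. w i \<noteq> 0 \<Longrightarrow> g0 w \<in> carrier_mat n n" "\<And>w. \<exists>i<3. w i \<noteq> 0 \<Longrightarrow> det (g0 w) \<noteq> 0"
    and local_lift: "\<And>w0. \<exists>i<3. w0 i \<noteq> 0 \<Longrightarrow> \<exists>G\<in>carrier_mat n n. ev w0 (det G) \<noteq> 0 \<and>
      (\<forall>w. (\<exists>i<3. w i \<noteq> 0) \<longrightarrow> ev w (det G) \<noteq> 0 \<longrightarrow>
        (\<exists>U\<in>carrier_mat n n. upper_triangular U \<and> map_mat (ev w) G = g0 w * U))"
    and homogeneous: "\<And>w t. \<exists>i<3. w i \<noteq> 0 \<Longrightarrow> t \<noteq> 0 \<Longrightarrow> g0 (\<lambda>i. t * w i) = g0 w"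
  shows "\<exists>h\<in>carrier_mat n n. \<forall>w. (\<exists>i<3. w i \<noteq> 0) \<longrightarrow>
    (\<exists>U\<in>carrier_mat n n. upper_triangular U \<and> g0 w = h * U)"
proof -
  \<comment> \<open>All polynomial local lifts at once, so that the family covers the punctured
    space.\<close>
  define \<G> where "\<G> = {G \<in> carrier_mat n n. det G \<noteq> 0 \<and>
      (\<forall>w. (\<exists>i<3. w i \<noteq> 0) \<longrightarrow> ev w (det G) \<noteq> 0 \<longrightarrow>
        (\<exists>U\<in>carrier_mat n n. upper_triangular U \<and> map_mat (ev w) G = g0 w * U))}"
  have det_ev: "det (map_mat (ev w) G) = ev w (det G)" for w G by simp
  have repr: "\<exists>U\<in>carrier_mat n n. upper_triangular U \<and> map_mat (ev w) G = g0 w * U \<and> det U \<noteq> 0"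
    if "G \<in> \<G>" "\<exists>i<3. w i \<noteq> 0" "ev w (det G) \<noteq> 0" for G w
  proof -
    have "\<exists>U\<in>carrier_mat n n. upper_triangular U \<and> map_mat (ev w) G = g0 w * U"
      using that(1) unfolding \<G>_def mem_Collect_eq
      by (elim conjE) (drule spec[of _ w], drule mp[OF _ that(2)], erule mp[OF _ that(3)])
    then obtain U where U: "U \<in> carrier_mat n n" "upper_triangular U" "map_mat (ev w) G = g0 w * U"
      by (elim bexE conjE)
    have "det (g0 w) * det U = ev w (det G)"
      using det_ev[of w G] det_mult[OF g0(1)[OF that(2)] U(1)] unfolding U(3) by simp
    then show ?thesis using that(3) U by auto
  qed
  have cover: "\<exists>G\<in>\<G>. ev w (det G) \<noteq> 0" if "\<exists>i<3. w i \<noteq> 0" for w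
    using local_lift[OF that] by (auto simp: \<G>_def)
  obtain G0 where G0: "G0 \<in> \<G>"
  proof -
    have "\<exists>i<3::nat. (1::complex) \<noteq> 0" by (intro exI[of _ 0]) simp
    from cover[OF this] show thesis using that by blast
  qed
  have flag: "rational_flag n \<G> G0"
  proof
    show "G \<in> carrier_mat n n" "det G \<noteq> 0" if "G \<in> \<G>" for G using that by (auto simp: \<G>_def)
    show "\<exists>G\<in>\<G>. ev w (det G) \<noteq> 0" if "\<exists>i<3. w i \<noteq> 0" for w by (rule cover[OF that])
    show "G0 \<in> \<G>" by (rule G0)
    fix G G' i j assume G: "G \<in> \<G>" "G' \<in> \<G>" and ij: "j < i" "i < n"
    then have Gc: "G \<in> carrier_mat n n" "G' \<in> carrier_mat n n" and d: "det G \<noteq> 0" "det G' \<noteq> 0"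
      by (auto simp: \<G>_def)
    note A = adj_mat(1)[OF Gc(1)]
    \<comment> \<open>Multiplying by both determinants makes the product vanish where one of the
      lifts degenerates. Elsewhere both lifts represent \<open>g0 w\<close>, which cancels and
      leaves triangular factors.\<close>
    have "ev w ((adj_mat G * G') $$ (i, j) * (det G * det G')) = 0" if "w 2 \<noteq> 0" for w
    proof (cases "ev w (det G) = 0 \<or> ev w (det G') = 0")
      case False
      have w: "\<exists>i<3. w i \<noteq> 0" using that by (intro exI[of _ 2]) simp
      obtain U where U: "U \<in> carrier_mat n n" "upper_triangular U" "map_mat (ev w) G = g0 w * U" "det U \<noteq> 0"
        using repr[OF G(1) w] False by blast
      obtain U' where U': "U' \<in> carrier_mat n n" "upper_triangular U'" "map_mat (ev w) G' = g0 w * U'" "det U' \<noteq> 0"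
        using repr[OF G(2) w] False by blast
      define X where "X = map_mat (ev w) (adj_mat G * G')"
      have X: "X \<in> carrier_mat n n" using A Gc by (auto simp: X_def)
      have "G * (adj_mat G * G') = G * adj_mat G * G'"
        by (rule assoc_mult_mat[symmetric, OF Gc(1) A Gc(2)])
      also have "\<dots> = det G \<cdot>\<^sub>m G'"
        unfolding adj_mat(2)[OF Gc(1)] mult_smult_assoc_mat[OF one_carrier_mat Gc(2)]
          left_mult_one_mat[OF Gc(2)] ..
      finally have "map_mat (ev w) (G * (adj_mat G * G')) = map_mat (ev w) (det G \<cdot>\<^sub>m G')" by simp
      then have "map_mat (ev w) G * X = ev w (det G) \<cdot>\<^sub>m map_mat (ev w) G'"
        unfolding X_def ev.mat_hom_mult[OF Gc(1) mult_carrier_mat[OF A Gc(2)]]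
        using Gc by (auto simp: ev.hom_mult intro!: eq_matI)
      then have "g0 w * (U * X) = g0 w * (ev w (det G) \<cdot>\<^sub>m U')"
        unfolding U(3) U'(3) assoc_mult_mat[OF g0(1)[OF w] U(1) X]
          mult_smult_distrib[OF g0(1)[OF w] U'(1)] .
      then have "U * X = ev w (det G) \<cdot>\<^sub>m U'"
        by (rule mat_cancel_left[OF g0(1)[OF w] g0(2)[OF w] mult_carrier_mat[OF U(1) X]
              smult_carrier_mat[OF U'(1)]])
      moreover have "upper_triangular (ev w (det G) \<cdot>\<^sub>m U')"
        using upper_triangularD[OF U'(2)] U'(1) by (auto intro!: upper_triangularI)
      ultimately have "upper_triangular X"
        by (intro upper_triangular_cancel_left[OF X U(1,2,4)]) simp
      then have "X $$ (i, j) = 0" using X ij by (intro upper_triangularD) auto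
      then show ?thesis using ij A Gc by (simp add: X_def ev.hom_mult)
    qed (auto simp: ev.hom_mult)
    then have "(adj_mat G * G') $$ (i, j) * (det G * det G') = 0" by (rule ev_eq_0_imp)
    then show "(adj_mat G * G') $$ (i, j) = 0" using d by simp
  qed
  obtain g C where g: "g \<in> carrier_mat n n" and C: "C \<in> carrier_mat n n" and gC: "g * C = 1\<^sub>m n"
    and CG: "\<And>G i j. G \<in> \<G> \<Longrightarrow> i < n \<Longrightarrow> j < i \<Longrightarrow> (C * G) $$ (i, j) = 0"
    using rational_flag.flag_trivial[OF flag] by metis
  \<comment> \<open>\<open>C * G\<close> is triangular as a polynomial matrix; evaluating at
    \<open>w\<close> and cancelling the invertible factor \<open>U\<close> transfers this to
    \<open>g0 w\<close>.\<close>
  have Cg0: "upper_triangular (map_mat (ev w) C * g0 w)" if w: "\<exists>i<3. w i \<noteq> 0" for w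
  proof -
    obtain G where G: "G \<in> \<G>" "ev w (det G) \<noteq> 0" using cover[OF w] by blast
    obtain U where U: "U \<in> carrier_mat n n" "upper_triangular U" "map_mat (ev w) G = g0 w * U" "det U \<noteq> 0"
      using repr[OF G(1) w G(2)] by blast
    have Gc: "G \<in> carrier_mat n n" using G by (simp add: \<G>_def)
    have Cw: "map_mat (ev w) C \<in> carrier_mat n n" using C by simp
    have "upper_triangular (map_mat (ev w) (C * G))"
      using CG[OF G(1)] C Gc by (intro upper_triangularI) auto
    also have "map_mat (ev w) (C * G) = map_mat (ev w) C * (g0 w * U)"
      unfolding U(3)[symmetric] by (rule ev.mat_hom_mult[OF C Gc])
    also have "\<dots> = map_mat (ev w) C * g0 w * U"
      by (rule assoc_mult_mat[symmetric, OF Cw g0(1)[OF w] U(1)])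
    finally show ?thesis
      by (rule upper_triangular_cancel_right[OF mult_carrier_mat[OF Cw g0(1)[OF w]] U(1,2,4)])
  qed
  \<comment> \<open>The global frame has polynomial entries, so it has a value at the origin, where
    nothing is known of \<open>g0\<close>.\<close>
  define h C0 where "h = map_mat (ev (\<lambda>_. 0)) g" and "C0 = map_mat (ev (\<lambda>_. 0)) C"
  have c: "h \<in> carrier_mat n n" "C0 \<in> carrier_mat n n" using g C by (auto simp: h_def C0_def)
  have "map_mat (ev (\<lambda>_. 0)) (g * C) = map_mat (ev (\<lambda>_. 0)) (1\<^sub>m n)" by (simp add: gC)
  then have hC: "h * C0 = 1\<^sub>m n"
    unfolding h_def C0_def ev.mat_hom_mult[OF g C] by (simp add: ev.mat_hom_one)
  have up: "upper_triangular (C0 * g0 w)" if w: "\<exists>i<3. w i \<noteq> 0" for w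
  proof (rule upper_triangularI)
    fix i j assume "j < i" "i < dim_row (C0 * g0 w)"
    then have ij: "j < i" "i < n" "j < n" using c by auto
    have idx: "(map_mat (ev w') C * g0 w) $$ (i, j) = (\<Sum>s<n. ev w' (C $$ (i, s)) * g0 w $$ (s, j))" for w'
      using index_mult_mat_sum[of "map_mat (ev w') C" n "g0 w" i j] g0(1)[OF w] C ij by simp
    obtain q where q: "\<And>s t. ev (\<lambda>i. t * w i) (C $$ (i, s)) = poly (q s) t"
      using ev_scaled_poly[of w "C $$ (i, _)"] by metis
    \<comment> \<open>At \<open>t\<close> this is the (i, j) entry of \<open>C\<close> at tw times
      \<open>g0 w\<close>. For t nonzero, scaling invariance replaces \<open>g0 w\<close> by the
      value at tw and the entry vanishes; hence it vanishes at t = 0.\<close>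
    define r where "r = (\<Sum>s<n. smult (g0 w $$ (s, j)) (q s))"
    have r: "poly r t = (map_mat (ev (\<lambda>i. t * w i)) C * g0 w) $$ (i, j)" for t
      unfolding idx by (simp add: r_def poly_sum q mult.commute)
    have "poly r t = 0" if "t \<noteq> 0" for t
    proof -
      have tw: "\<exists>i<3. t * w i \<noteq> 0" using w that by auto
      show ?thesis
        using Cg0[OF tw] ij C g0(1)[OF w] unfolding r homogeneous[OF w that]
        by (intro upper_triangularD) auto
    qed
    moreover have "infinite (UNIV - {0::complex})" by (simp add: infinite_UNIV_char_0)
    ultimately have "r = 0" by (intro poly_zero_on_infinite[of "UNIV - {0}"]) auto
    then show "(C0 * g0 w) $$ (i, j) = 0" using r[of 0] by (simp add: C0_def)
  qed
  have eq: "g0 w = h * (C0 * g0 w)" if w: "\<exists>i<3. w i \<noteq> 0" for w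
    unfolding assoc_mult_mat[OF c g0(1)[OF w], symmetric] hC left_mult_one_mat[OF g0(1)[OF w]] ..
  show ?thesis
  proof (rule bexI[OF _ c(1)], intro allI impI)
    fix w assume w: "\<exists>i<3. (w :: nat \<Rightarrow> complex) i \<noteq> 0"
    show "\<exists>U\<in>carrier_mat n n. upper_triangular U \<and> g0 w = h * U"
      by (rule bexI[where x = "C0 * g0 w"])
        (rule conjI[OF up[OF w] eq[OF w]], rule mult_carrier_mat[OF c(2) g0(1)[OF w]])
  qed
qed

section \<open>The big cell\<close>

definition lower_unitriangular :: "nat \<Rightarrow> 'a::comm_ring_1 mat \<Rightarrow> bool" where
  "lower_unitriangular n L \<longleftrightarrow> L \<in> carrier_mat n n \<and>
     (\<forall>i<n. \<forall>j<n. i \<le> j \<longrightarrow> L $$ (i, j) = (if i = j then 1 else 0))"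

lemma det_lower_unitriangular:
  assumes "lower_unitriangular n L"
  shows "det L = 1"
proof -
  have L: "L \<in> carrier_mat n n" using assms by (simp add: lower_unitriangular_def)
  have "det L = prod_list (diag_mat L)"
    using assms by (intro det_lower_triangular[OF _ L]) (auto simp: lower_unitriangular_def)
  also have "\<dots> = (\<Prod>i\<in>{0..<n}. L $$ (i, i))" using L by (simp add: prod_list_diag_prod)
  also have "\<dots> = 1" using assms by (intro prod.neutral) (auto simp: lower_unitriangular_def)
  finally show ?thesis .
qed

text \<open>Lower unitriangular and upper triangular matrices share only the identity: row by row,
  the entries on and above the diagonal show that \<open>b\<close> is the identity.\<close>

lemma lower_unitriangular_unique:
  assumes L: "lower_unitriangular n L" and L': "lower_unitriangular n L'"
    and b: "b \<in> carrier_mat n n" "upper_triangular b" and eq: "L * b = L'"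
  shows "L = L'"
proof -
  have Lc: "L \<in> carrier_mat n n" using L by (simp add: lower_unitriangular_def)
  have "b $$ (i, j) = (if i = j then 1 else 0)" if "i < n" "j < n" for i j
    using that
  proof (induction i arbitrary: j rule: less_induct)
    case (less i)
    show ?case
    proof (cases "j < i")
      case True
      then show ?thesis using b less.prems upper_triangularD[of b j i] by simp
    next
      case False
      have "L' $$ (i, j) = (\<Sum>s<n. L $$ (i, s) * b $$ (s, j))"
        unfolding eq[symmetric] using Lc b less.prems by (intro index_mult_mat_sum)
      also have "\<dots> = (\<Sum>s\<in>{i}. L $$ (i, s) * b $$ (s, j))"
      proof (intro sum.mono_neutral_right ballI)
        fix s assume s: "s \<in> {..<n} - {i}"
        show "L $$ (i, s) * b $$ (s, j) = 0"
        proof (cases "s < i")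
          case True
          then show ?thesis using less.IH[OF True] less.prems False by simp
        next
          case False
          then show ?thesis using s L less.prems by (simp add: lower_unitriangular_def)
        qed
      qed (use less.prems in auto)
      finally have "L' $$ (i, j) = b $$ (i, j)"
        using L less.prems by (simp add: lower_unitriangular_def)
      then show ?thesis using False L' less.prems by (simp add: lower_unitriangular_def)
    qed
  qed
  then have "b = 1\<^sub>m n" using b(1) by (intro eq_matI) auto
  then show ?thesis using eq Lc by simp
qed

definition leading :: "nat \<Rightarrow> 'a mat \<Rightarrow> 'a mat" where
  "leading k X = mat k k (\<lambda>(i, j). X $$ (i, j))"

lemma leading_carrier [simp]: "leading k X \<in> carrier_mat k k"
  by (simp add: leading_def)

lemma index_leading [simp]: "i < k \<Longrightarrow> j < k \<Longrightarrow> leading k X $$ (i, j) = X $$ (i, j)"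
  by (simp add: leading_def)

text \<open>Below row k the first k columns of an upper triangular \<open>b\<close> are zero, so the
  leading blocks multiply.\<close>

lemma leading_mult_upper:
  fixes X b :: "'a::comm_ring_1 mat"
  assumes X: "X \<in> carrier_mat n n" and b: "b \<in> carrier_mat n n" "upper_triangular b" and k: "k \<le> n"
  shows "leading k (X * b) = leading k X * leading k b"
proof (rule eq_matI)
  fix i j assume "i < dim_row (leading k X * leading k b)" "j < dim_col (leading k X * leading k b)"
  then have ij: "i < k" "j < k" by (auto simp: leading_def)
  have "(X * b) $$ (i, j) = (\<Sum>s<n. X $$ (i, s) * b $$ (s, j))"
    using X b ij k by (intro index_mult_mat_sum) auto
  also have "\<dots> = (\<Sum>s<k. X $$ (i, s) * b $$ (s, j))"
    using ij k b upper_triangularD[of b j] by (intro sum.mono_neutral_right) auto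
  also have "\<dots> = (leading k X * leading k b) $$ (i, j)"
    using ij by (subst index_mult_mat_sum[of _ k]) auto
  finally show "leading k (X * b) $$ (i, j) = (leading k X * leading k b) $$ (i, j)"
    using ij by simp
qed (auto simp: leading_def)

lemma det_leading_upper:
  fixes b :: "'a::idom mat"
  assumes b: "b \<in> carrier_mat n n" "upper_triangular b" "det b \<noteq> 0" and k: "k \<le> n"
  shows "det (leading k b) \<noteq> 0"
proof -
  have nz: "b $$ (i, i) \<noteq> 0" if "i < n" for i
    using b that unfolding det_upper_triangular[OF b(2,1)] by (auto simp: diag_mat_def prod_list_zero_iff)
  have "upper_triangular (leading k b)"
    using b k upper_triangularD[of b] by (intro upper_triangularI) (auto simp: leading_def)
  then have "det (leading k b) = prod_list (diag_mat (leading k b))"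
    by (rule det_upper_triangular[OF _ leading_carrier])
  then show ?thesis using nz k by (auto simp: diag_mat_def prod_list_zero_iff leading_def)
qed

text \<open>Nonzero leading minors are the criterion for an LU factorisation, that is, for
  membership in the open cell.\<close>

definition big_cell :: "nat \<Rightarrow> complex mat \<Rightarrow> bool" where
  "big_cell n X \<longleftrightarrow> (\<forall>k\<le>n. det (leading k X) \<noteq> 0)"

text \<open>Cramer's rule: column j of the lower factor combines the first j + 1 columns of
  \<open>X\<close>, weighted by the last column of the inverse of the leading block of size
  \<open>Suc j\<close>. This is its numerator, polynomial in \<open>X\<close>.\<close>

definition lower_num :: "complex mat \<Rightarrow> nat \<Rightarrow> nat \<Rightarrow> complex" where
  "lower_num X i j = (\<Sum>s<Suc j. X $$ (i, s) * adj_mat (leading (Suc j) X) $$ (s, j))"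

definition lower_factor :: "nat \<Rightarrow> complex mat \<Rightarrow> complex mat" where
  "lower_factor n X = mat n n (\<lambda>(i, j). lower_num X i j / det (leading (Suc j) X))"

lemma big_cell_mult_upper:
  assumes X: "X \<in> carrier_mat n n" and b: "b \<in> carrier_mat n n" "upper_triangular b" "det b \<noteq> 0"
  shows "big_cell n (X * b) \<longleftrightarrow> big_cell n X"
proof -
  have "det (leading k (X * b)) = det (leading k X) * det (leading k b)" if "k \<le> n" for k
    unfolding leading_mult_upper[OF X b(1,2) that] by (rule det_mult[of _ k]) simp_all
  then show ?thesis using det_leading_upper[OF b] by (auto simp: big_cell_def)
qed

lemma lower_factor:
  assumes X: "X \<in> carrier_mat n n" "big_cell n X"
  shows "lower_unitriangular n (lower_factor n X)"
    and "\<exists>T\<in>carrier_mat n n. upper_triangular T \<and> lower_factor n X = X * T"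
proof -
  show "lower_unitriangular n (lower_factor n X)"
    unfolding lower_unitriangular_def
  proof (intro conjI allI impI)
    show "lower_factor n X \<in> carrier_mat n n" by (simp add: lower_factor_def)
    fix i j assume ij: "i < n" "j < n" "i \<le> j"
    let ?A = "leading (Suc j) X"
    \<comment> \<open>For i \<le> j row i lies inside the leading block, where the sum is an entry
      of a matrix times its adjugate.\<close>
    have "lower_num X i j = (\<Sum>s<Suc j. ?A $$ (i, s) * adj_mat ?A $$ (s, j))"
      unfolding lower_num_def using ij by (intro sum.cong) auto
    also have "\<dots> = (?A * adj_mat ?A) $$ (i, j)"
      using ij by (intro index_mult_mat_sum[symmetric] adj_mat(1)) auto
    also have "\<dots> = (if i = j then det ?A else 0)"
      using ij by (simp add: adj_mat(2)[of ?A "Suc j"])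
    finally show "lower_factor n X $$ (i, j) = (if i = j then 1 else 0)"
      using X(2) ij by (simp add: lower_factor_def big_cell_def)
  qed
  define T where "T = mat n n (\<lambda>(s, j). if s \<le> j then
    adj_mat (leading (Suc j) X) $$ (s, j) / det (leading (Suc j) X) else 0)"
  have T: "T \<in> carrier_mat n n" by (simp add: T_def)
  moreover have "upper_triangular T" by (rule upper_triangularI) (simp add: T_def)
  moreover have "lower_factor n X = X * T"
  proof (rule eq_matI)
    fix i j assume "i < dim_row (X * T)" "j < dim_col (X * T)"
    then have ij: "i < n" "j < n" using X T by auto
    have "(X * T) $$ (i, j) = (\<Sum>s<n. X $$ (i, s) * T $$ (s, j))"
      using X T ij by (intro index_mult_mat_sum) auto
    also have "\<dots> = (\<Sum>s<Suc j. X $$ (i, s) * (adj_mat (leading (Suc j) X) $$ (s, j) / det (leading (Suc j) X)))"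
      using ij by (intro sum.mono_neutral_cong_right) (auto simp: T_def)
    also have "\<dots> = lower_factor n X $$ (i, j)"
      using ij by (simp only: lower_factor_def lower_num_def index_mat sum_divide_distrib split times_divide_eq_right)
    finally show "lower_factor n X $$ (i, j) = (X * T) $$ (i, j)" by simp
  qed (use X T in \<open>auto simp: lower_factor_def\<close>)
  ultimately show "\<exists>T\<in>carrier_mat n n. upper_triangular T \<and> lower_factor n X = X * T" by blast
qed

section \<open>Polynomial functions on matrices\<close>

text \<open>Closure under ring operations, determinants and adjugates produces the polynomials for
  regularity on \<open>SL n\<close> without writing them down.\<close>

definition poly_fun :: "nat \<Rightarrow> (complex mat \<Rightarrow> complex) \<Rightarrow> bool" where
  "poly_fun n f \<longleftrightarrow> (\<exists>p\<in>entry_polys n. \<forall>A\<in>carrier_mat n n. f A = eval_at_mat p A)"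

lemma poly_fun_const: "poly_fun n (\<lambda>A. c)"
  unfolding poly_fun_def
  by (intro bexI[of _ "Poly_Mapping.single 0 c"])
    (auto simp: eval_poly_single eval_monom_def polys_in_def)

lemma poly_fun_entry:
  assumes "i < n" "j < n"
  shows "poly_fun n (\<lambda>A. A $$ (i, j))"
  unfolding poly_fun_def
  by (intro bexI[of _ "Poly_Mapping.single (Poly_Mapping.single (i, j) 1) 1"])
    (use assms in \<open>auto simp: eval_poly_single eval_monom_def polys_in_def\<close>)

lemma poly_fun_add:
  assumes "poly_fun n f" "poly_fun n g"
  shows "poly_fun n (\<lambda>A. f A + g A)"
proof -
  obtain p q where "p \<in> entry_polys n" "\<forall>A\<in>carrier_mat n n. f A = eval_at_mat p A"
    "q \<in> entry_polys n" "\<forall>A\<in>carrier_mat n n. g A = eval_at_mat q A"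
    using assms by (auto simp: poly_fun_def)
  moreover from this have "p + q \<in> entry_polys n"
    using Poly_Mapping.keys_add[of p q] unfolding polys_in_def by blast
  ultimately show ?thesis
    unfolding poly_fun_def by (intro bexI[of _ "p + q"]) (auto simp: eval_poly_add)
qed

lemma poly_fun_mult:
  assumes "poly_fun n f" "poly_fun n g"
  shows "poly_fun n (\<lambda>A. f A * g A)"
proof -
  obtain p q where "p \<in> entry_polys n" "\<forall>A\<in>carrier_mat n n. f A = eval_at_mat p A"
    "q \<in> entry_polys n" "\<forall>A\<in>carrier_mat n n. g A = eval_at_mat q A"
    using assms by (auto simp: poly_fun_def)
  then show ?thesis
    unfolding poly_fun_def by (intro bexI[of _ "p * q"] polys_in_mult) (auto simp: eval_poly_mult)
qed

lemma poly_fun_sum: "(\<And>x. x \<in> S \<Longrightarrow> poly_fun n (f x)) \<Longrightarrow> poly_fun n (\<lambda>A. \<Sum>x\<in>S. f x A)"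
  by (induction S rule: infinite_finite_induct) (auto intro: poly_fun_const poly_fun_add)

lemma poly_fun_prod: "(\<And>x. x \<in> S \<Longrightarrow> poly_fun n (f x)) \<Longrightarrow> poly_fun n (\<lambda>A. \<Prod>x\<in>S. f x A)"
  by (induction S rule: infinite_finite_induct) (auto intro: poly_fun_const poly_fun_mult)

lemma poly_fun_det:
  assumes "\<And>A. F A \<in> carrier_mat k k" "\<And>i j. i < k \<Longrightarrow> j < k \<Longrightarrow> poly_fun n (\<lambda>A. F A $$ (i, j))"
  shows "poly_fun n (\<lambda>A. det (F A))"
proof -
  have "p i < k" if "p permutes {0..<k}" "i < k" for p i
    using permutes_in_image[OF that(1), of i] that(2) by simp
  then show ?thesis
    unfolding det_def'[OF assms(1)]
    by (intro poly_fun_sum poly_fun_mult poly_fun_prod poly_fun_const assms(2)) auto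
qed

lemma poly_fun_adj_mat:
  assumes F: "\<And>A. F A \<in> carrier_mat k k" "\<And>i j. i < k \<Longrightarrow> j < k \<Longrightarrow> poly_fun n (\<lambda>A. F A $$ (i, j))"
    and ij: "i < k" "j < k"
  shows "poly_fun n (\<lambda>A. adj_mat (F A) $$ (i, j))"
proof -
  have dims: "dim_row (F A) = k" "dim_col (F A) = k" for A using F(1)[of A] by auto
  have "poly_fun n (\<lambda>A. det (mat_delete (F A) j i))"
  proof (rule poly_fun_det)
    show "mat_delete (F A) j i \<in> carrier_mat (k - 1) (k - 1)" for A by (rule mat_delete_carrier[OF F(1)])
    fix i' j' assume "i' < k - 1" "j' < k - 1"
    then show "poly_fun n (\<lambda>A. mat_delete (F A) j i $$ (i', j'))"
      unfolding mat_delete_def dims by (auto intro: F(2))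
  qed
  then have "poly_fun n (\<lambda>A. (-1) ^ (j + i) * det (mat_delete (F A) j i))"
    by (intro poly_fun_mult poly_fun_const)
  then show ?thesis using ij by (simp add: adj_mat_def dims cofactor_def)
qed

lemma poly_fun_mult_left:
  assumes a: "a \<in> carrier_mat n n" and ij: "i < n" "j < n"
  shows "poly_fun n (\<lambda>A. (a * A) $$ (i, j))"
proof -
  have "poly_fun n (\<lambda>A. \<Sum>s<n. a $$ (i, s) * A $$ (s, j))"
    using ij by (intro poly_fun_sum poly_fun_mult poly_fun_const poly_fun_entry) auto
  moreover have "(a * A) $$ (i, j) = (\<Sum>s<n. a $$ (i, s) * A $$ (s, j))" if "A \<in> carrier_mat n n" for A
    using a that ij by (intro index_mult_mat_sum)
  ultimately show ?thesis by (simp add: poly_fun_def)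
qed

lemma poly_fun_leading:
  assumes a: "a \<in> carrier_mat n n" and ij: "i < k" "j < k" "k \<le> n"
  shows "poly_fun n (\<lambda>A. leading k (a * A) $$ (i, j))"
  using poly_fun_mult_left[OF a, of i j] ij by simp

lemma poly_fun_det_leading:
  assumes "a \<in> carrier_mat n n" "k \<le> n"
  shows "poly_fun n (\<lambda>A. det (leading k (a * A)))"
  using assms by (intro poly_fun_det[of _ k] poly_fun_leading) auto

lemma poly_fun_lower_num:
  assumes a: "a \<in> carrier_mat n n" and ij: "i < n" "j < n"
  shows "poly_fun n (\<lambda>A. lower_num (a * A) i j)"
  unfolding lower_num_def using ij
  by (intro poly_fun_sum poly_fun_mult poly_fun_mult_left[OF a] poly_fun_adj_mat[of _ "Suc j"]
      poly_fun_leading[OF a]) auto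

section \<open>Coordinates on the flag variety\<close>

lemma SL_simps:
  "carrier (SL n) = {A \<in> carrier_mat n n. det A = 1}" "A \<otimes>\<^bsub>SL n\<^esub> B = A * B" "\<one>\<^bsub>SL n\<^esub> = 1\<^sub>m n"
  by (simp_all add: SL_def)

lemma mem_borel: "b \<in> borel n \<longleftrightarrow> b \<in> carrier_mat n n \<and> upper_triangular b \<and> det b = 1"
  by (auto simp: borel_def SL_simps)

lemma mem_coset: "x \<in> g <#\<^bsub>SL n\<^esub> borel n \<longleftrightarrow> (\<exists>b\<in>borel n. x = g * b)"
  by (auto simp: l_coset_def SL_simps)

lemma one_borel: "1\<^sub>m n \<in> borel n"
  by (auto simp: mem_borel intro!: upper_triangularI)

lemma borel_mult: "b \<in> borel n \<Longrightarrow> c \<in> borel n \<Longrightarrow> b * c \<in> borel n"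
  by (auto simp: mem_borel det_mult[of _ n] intro: upper_triangular_mult)

lemma mult_adj_mat_SL:
  assumes "a \<in> carrier_mat n n" "det a = (1::complex)"
  shows "a * adj_mat a = 1\<^sub>m n" "adj_mat a * a = 1\<^sub>m n" "det (adj_mat a) = 1"
proof -
  show *: "a * adj_mat a = 1\<^sub>m n" "adj_mat a * a = 1\<^sub>m n"
    using adj_mat(2,3)[OF assms(1)] assms(2) by (auto intro!: eq_matI)
  have "det (a * adj_mat a) = 1" unfolding * by simp
  then show "det (adj_mat a) = 1"
    using assms(2) by (simp add: det_mult[OF assms(1) adj_mat(1)[OF assms(1)]])
qed

lemma borel_adj_mat: "b \<in> borel n \<Longrightarrow> adj_mat b \<in> borel n"
  by (auto simp: mem_borel mult_adj_mat_SL(3) adj_mat(1) intro: upper_triangular_adj_mat)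

lemma mult_adj_mat_cancel:
  assumes "b \<in> borel n" "g \<in> carrier_mat n n"
  shows "g * b * adj_mat b = g"
proof -
  have b: "b \<in> carrier_mat n n" "det b = 1" using assms(1) by (auto simp: mem_borel)
  have "g * b * adj_mat b = g * (b * adj_mat b)"
    by (rule assoc_mult_mat[OF assms(2) b(1) adj_mat(1)[OF b(1)]])
  then show ?thesis
    unfolding mult_adj_mat_SL(1)[OF b] right_mult_one_mat[OF assms(2)] .
qed

lemma coset_mult_borel:
  assumes g: "g \<in> carrier_mat n n" and b: "b \<in> borel n"
  shows "(g * b) <#\<^bsub>SL n\<^esub> borel n = g <#\<^bsub>SL n\<^esub> borel n"
proof (rule Set.set_eqI)
  fix x
  have bc: "b \<in> carrier_mat n n" using b by (simp add: mem_borel)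
  have assoc: "g * b * c = g * (b * c)" if "c \<in> borel n" for c
    using that by (intro assoc_mult_mat[OF g bc, of _ n]) (simp add: mem_borel)
  show "x \<in> (g * b) <#\<^bsub>SL n\<^esub> borel n \<longleftrightarrow> x \<in> g <#\<^bsub>SL n\<^esub> borel n"
  proof
    assume "x \<in> (g * b) <#\<^bsub>SL n\<^esub> borel n"
    then show "x \<in> g <#\<^bsub>SL n\<^esub> borel n"
      unfolding mem_coset using assoc borel_mult[OF b] by blast
  next
    assume "x \<in> g <#\<^bsub>SL n\<^esub> borel n"
    then obtain c where c: "c \<in> borel n" "x = g * c" unfolding mem_coset by blast
    have "x = g * b * adj_mat b * c" unfolding mult_adj_mat_cancel[OF b g] c(2) ..
    also have "\<dots> = g * b * (adj_mat b * c)"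
      using c(1) g bc by (intro assoc_mult_mat[of _ n n _ n _ n] mult_carrier_mat[of _ n n] adj_mat(1))
        (simp_all add: mem_borel)
    finally show "x \<in> (g * b) <#\<^bsub>SL n\<^esub> borel n"
      unfolding mem_coset using borel_mult[OF borel_adj_mat[OF b] c(1)] by blast
  qed
qed

lemma mem_coset_rel:
  assumes g: "g \<in> carrier_mat n n" and x: "x \<in> g <#\<^bsub>SL n\<^esub> borel n" and y: "y \<in> g <#\<^bsub>SL n\<^esub> borel n"
  obtains c where "c \<in> borel n" "y = x * c"
proof -
  obtain b b' where b: "b \<in> borel n" "x = g * b" and b': "b' \<in> borel n" "y = g * b'"
    using x y unfolding mem_coset by blast
  have xc: "x \<in> carrier_mat n n"
    unfolding b(2) using b(1) by (intro mult_carrier_mat[OF g]) (simp add: mem_borel)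
  have "y \<in> x <#\<^bsub>SL n\<^esub> borel n"
    using y unfolding b(2) coset_mult_borel[OF g b(1)] .
  then show thesis using that unfolding mem_coset by blast
qed

text \<open>The coordinates of the open cell \<open>a U\<^sup>- B/B\<close> of \<open>G/B\<close>; each of its points is \<open>a L B\<close> for exactly one
  lower unitriangular \<open>L\<close>.\<close>

definition cell_coord :: "nat \<Rightarrow> complex mat \<Rightarrow> nat \<Rightarrow> nat \<Rightarrow> complex mat set \<Rightarrow> complex" where
  "cell_coord n a i j S = (SOME L. lower_unitriangular n L \<and> a * L \<in> S) $$ (i, j)"

text \<open>The translate by \<open>a\<close> of the open cell: for \<open>a\<close> in
  \<open>SL n\<close> the inverse is \<open>adj_mat a\<close>.\<close>

definition cell :: "nat \<Rightarrow> complex mat \<Rightarrow> complex mat set set" where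
  "cell n a = {g <#\<^bsub>SL n\<^esub> borel n | g. g \<in> carrier (SL n) \<and> big_cell n (adj_mat a * g)}"

context
  fixes n :: nat and a :: "complex mat"
  assumes a: "a \<in> carrier (SL n)"
begin

lemma a_carrier: "a \<in> carrier_mat n n" "det a = 1"
  using a by (auto simp: SL_simps)

lemma adj_a_carrier: "adj_mat a \<in> carrier_mat n n"
  by (rule adj_mat(1)[OF a_carrier(1)])

lemma coset_in_cell_iff:
  assumes g: "g \<in> carrier (SL n)"
  shows "g <#\<^bsub>SL n\<^esub> borel n \<in> cell n a \<longleftrightarrow> big_cell n (adj_mat a * g)"
proof
  have gc: "g \<in> carrier_mat n n" using g by (simp add: SL_simps)
  assume "g <#\<^bsub>SL n\<^esub> borel n \<in> cell n a"
  then obtain g' where g': "g' \<in> carrier_mat n n" "big_cell n (adj_mat a * g')"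
    "g <#\<^bsub>SL n\<^esub> borel n = g' <#\<^bsub>SL n\<^esub> borel n" by (auto simp: cell_def SL_simps)
  have "g \<in> g <#\<^bsub>SL n\<^esub> borel n"
    unfolding mem_coset by (rule bexI[OF _ one_borel]) (simp add: right_mult_one_mat[OF gc])
  then obtain b where b: "b \<in> borel n" "g = g' * b" unfolding g'(3) mem_coset by blast
  have bc: "b \<in> carrier_mat n n" "upper_triangular b" "det b \<noteq> 0" using b(1) by (auto simp: mem_borel)
  have "adj_mat a * g = adj_mat a * g' * b"
    unfolding b(2) by (rule assoc_mult_mat[symmetric, OF adj_a_carrier g'(1) bc(1)])
  then show "big_cell n (adj_mat a * g)"
    using g'(2) big_cell_mult_upper[OF mult_carrier_mat[OF adj_a_carrier g'(1)] bc] by simp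
qed (use g in \<open>auto simp: cell_def\<close>)

text \<open>The triangular factor \<open>T\<close> between \<open>adj_mat a * g\<close> and its
  lower factor has determinant 1, since both of these do; so it lies in the Borel subgroup and
  leaves the coset unchanged.\<close>

lemma lower_factor_in_coset:
  assumes g: "g \<in> carrier (SL n)" and cell: "big_cell n (adj_mat a * g)"
  shows "lower_unitriangular n (lower_factor n (adj_mat a * g))"
    and "a * lower_factor n (adj_mat a * g) \<in> g <#\<^bsub>SL n\<^esub> borel n"
proof -
  have gc: "g \<in> carrier_mat n n" and dg: "det g = 1" using g by (auto simp: SL_simps)
  let ?X = "adj_mat a * g" and ?L = "lower_factor n (adj_mat a * g)"
  have X: "?X \<in> carrier_mat n n" by (rule mult_carrier_mat[OF adj_a_carrier gc])
  show L: "lower_unitriangular n ?L" by (rule lower_factor(1)[OF X cell])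
  obtain T where T: "T \<in> carrier_mat n n" "upper_triangular T" "?L = ?X * T"
    using lower_factor(2)[OF X cell] by blast
  have "det ?X = 1"
    using mult_adj_mat_SL(3)[OF a_carrier] dg by (simp add: det_mult[OF adj_a_carrier gc])
  then have "det T = 1"
    using det_lower_unitriangular[OF L] unfolding T(3) by (simp add: det_mult[OF X T(1)])
  then have "T \<in> borel n" using T by (simp add: mem_borel)
  moreover have "a * ?L = g * T"
  proof -
    have "a * ?L = a * ?X * T"
      unfolding T(3) by (rule assoc_mult_mat[symmetric, OF a_carrier(1) X T(1)])
    also have "a * ?X = a * adj_mat a * g"
      by (rule assoc_mult_mat[symmetric, OF a_carrier(1) adj_a_carrier gc])
    also have "\<dots> = g" unfolding mult_adj_mat_SL(1)[OF a_carrier] by (rule left_mult_one_mat[OF gc])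
    finally show ?thesis .
  qed
  ultimately show "a * ?L \<in> g <#\<^bsub>SL n\<^esub> borel n" unfolding mem_coset by blast
qed

text \<open>Two candidates differ by a Borel element on the right, so uniqueness of the lower factor
  determines the choice.\<close>

lemma SOME_lower_factor:
  assumes g: "g \<in> carrier (SL n)" and cell: "big_cell n (adj_mat a * g)"
  shows "(SOME L. lower_unitriangular n L \<and> a * L \<in> g <#\<^bsub>SL n\<^esub> borel n) = lower_factor n (adj_mat a * g)"
proof (rule some_equality)
  note L = lower_factor_in_coset[OF g cell]
  show "lower_unitriangular n (lower_factor n (adj_mat a * g)) \<and>
      a * lower_factor n (adj_mat a * g) \<in> g <#\<^bsub>SL n\<^esub> borel n" using L by simp
  fix L' assume L': "lower_unitriangular n L' \<and> a * L' \<in> g <#\<^bsub>SL n\<^esub> borel n"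
  have gc: "g \<in> carrier_mat n n" using g by (simp add: SL_simps)
  obtain c where c: "c \<in> borel n" "a * lower_factor n (adj_mat a * g) = a * L' * c"
    using mem_coset_rel[OF gc conjunct2[OF L'] L(2)] by blast
  have cc: "c \<in> carrier_mat n n" "upper_triangular c" using c(1) by (auto simp: mem_borel)
  have Lc: "L' \<in> carrier_mat n n" "lower_factor n (adj_mat a * g) \<in> carrier_mat n n"
    using L L' by (auto simp: lower_unitriangular_def)
  have "L' * c = lower_factor n (adj_mat a * g)"
  proof (rule mat_cancel_left[OF a_carrier(1) _ mult_carrier_mat[OF Lc(1) cc(1)] Lc(2)])
    show "a * (L' * c) = a * lower_factor n (adj_mat a * g)"
      unfolding c(2) by (rule assoc_mult_mat[symmetric, OF a_carrier(1) Lc(1) cc(1)])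
  qed (simp add: a_carrier)
  then show "L' = lower_factor n (adj_mat a * g)"
    using lower_unitriangular_unique[OF conjunct1[OF L'] L(1) cc] by simp
qed

lemma cell_coord_mat:
  assumes S: "S \<in> cell n a"
  shows "lower_unitriangular n (mat n n (\<lambda>(i, j). cell_coord n a i j S))"
    and "a * mat n n (\<lambda>(i, j). cell_coord n a i j S) \<in> S"
proof -
  obtain g where g: "g \<in> carrier (SL n)" "big_cell n (adj_mat a * g)" "S = g <#\<^bsub>SL n\<^esub> borel n"
    using S by (auto simp: cell_def)
  have "mat n n (\<lambda>(i, j). cell_coord n a i j S) = lower_factor n (adj_mat a * g)"
    unfolding cell_coord_def g(3) SOME_lower_factor[OF g(1,2)]
    by (rule eq_matI) (auto simp: lower_factor_def)
  then show "lower_unitriangular n (mat n n (\<lambda>(i, j). cell_coord n a i j S))"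
    "a * mat n n (\<lambda>(i, j). cell_coord n a i j S) \<in> S"
    using lower_factor_in_coset[OF g(1,2)] g(3) by simp_all
qed

text \<open>The product of the leading minors is a single polynomial whose nonvanishing cuts out the
  cell.\<close>

lemma SL_open_cell: "SL_open n {g \<in> carrier (SL n). big_cell n (adj_mat a * g)}"
proof -
  have "poly_fun n (\<lambda>g. \<Prod>k\<in>{..n}. det (leading k (adj_mat a * g)))"
    by (intro poly_fun_prod poly_fun_det_leading[OF adj_a_carrier]) simp
  then obtain p where p: "p \<in> entry_polys n"
    "\<And>g. g \<in> carrier_mat n n \<Longrightarrow> (\<Prod>k\<in>{..n}. det (leading k (adj_mat a * g))) = eval_at_mat p g"
    by (auto simp: poly_fun_def)
  have "big_cell n (adj_mat a * g) \<longleftrightarrow> eval_at_mat p g \<noteq> 0" if "g \<in> carrier (SL n)" for g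
    using p(2)[of g] that by (auto simp: big_cell_def SL_simps simp flip: p(2))
  then have "{g \<in> carrier (SL n). big_cell n (adj_mat a * g)} =
      {A \<in> carrier (SL n). \<not> (\<forall>p\<in>{p}. eval_at_mat p A = 0)}" by auto
  then show ?thesis unfolding SL_open_def using p(1) by (intro exI[of _ "{p}"]) simp
qed

lemma cell_preimage:
  "{g \<in> carrier (SL n). g <#\<^bsub>SL n\<^esub> borel n \<in> cell n a} = {g \<in> carrier (SL n). big_cell n (adj_mat a * g)}"
  using coset_in_cell_iff by blast

lemma openin_cell: "openin (zariski (flag_variety n)) (cell n a)"
  unfolding flag_variety_def openin_quotient_fspace points_SL_variety cell_preimage openin_SL_variety
  using SL_open_cell by (auto simp: cell_def)

lemma coset_self_in_cell: "a <#\<^bsub>SL n\<^esub> borel n \<in> cell n a"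
proof -
  have "leading k (1\<^sub>m n) = (1\<^sub>m k :: complex mat)" if "k \<le> n" for k
    using that by (intro eq_matI) (auto simp: leading_def)
  then show ?thesis
    unfolding coset_in_cell_iff[OF a] mult_adj_mat_SL(2)[OF a_carrier] by (simp add: big_cell_def)
qed

text \<open>Regularity on the quotient is tested on \<open>SL n\<close>, where the coordinate is one
  quotient on the whole cell: \<open>lower_num\<close> over a leading minor.\<close>

lemma cell_coord_regular:
  assumes ij: "i < n" "j < n"
  shows "cell_coord n a i j \<in> regular (flag_variety n) (cell n a)"
proof -
  let ?U = "{g \<in> carrier (SL n). big_cell n (adj_mat a * g)}"
  obtain p where p: "p \<in> entry_polys n"
    "\<And>g. g \<in> carrier_mat n n \<Longrightarrow> lower_num (adj_mat a * g) i j = eval_at_mat p g"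
    using poly_fun_lower_num[OF adj_a_carrier ij] by (auto simp: poly_fun_def)
  obtain q where q: "q \<in> entry_polys n"
    "\<And>g. g \<in> carrier_mat n n \<Longrightarrow> det (leading (Suc j) (adj_mat a * g)) = eval_at_mat q g"
    using poly_fun_det_leading[OF adj_a_carrier, of "Suc j"] ij by (auto simp: poly_fun_def)
  have quot: "eval_at_mat q g \<noteq> 0 \<and>
      (cell_coord n a i j \<circ> (\<lambda>g. g <#\<^bsub>SL n\<^esub> borel n)) g = eval_at_mat p g / eval_at_mat q g"
    if "g \<in> ?U" for g
  proof -
    have g: "g \<in> carrier (SL n)" "big_cell n (adj_mat a * g)" "g \<in> carrier_mat n n"
      using that by (auto simp: SL_simps)
    show ?thesis
      using g(2) ij unfolding cell_coord_def o_def SOME_lower_factor[OF g(1,2)] p(2)[OF g(3), symmetric]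
        q(2)[OF g(3), symmetric]
      by (auto simp: lower_factor_def big_cell_def)
  qed
  have "\<forall>A\<in>?U. \<exists>V. \<exists>p\<in>entry_polys n. \<exists>q\<in>entry_polys n. SL_open n V \<and> A \<in> V \<and> V \<subseteq> ?U \<and>
      (\<forall>M\<in>V. eval_at_mat q M \<noteq> 0 \<and>
        (cell_coord n a i j \<circ> (\<lambda>g. g <#\<^bsub>SL n\<^esub> borel n)) M = eval_at_mat p M / eval_at_mat q M)"
    by (intro ballI exI[of _ ?U] bexI[OF _ p(1)] bexI[OF _ q(1)] conjI SL_open_cell subset_refl
        conjunct1[OF quot] conjunct2[OF quot])
  then have "cell_coord n a i j \<circ> (\<lambda>g. g <#\<^bsub>SL n\<^esub> borel n) \<in> regular (SL_variety n) ?U"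
    by (simp only: SL_variety_def fspace.select_convs mem_Collect_eq)
  then show ?thesis
    unfolding flag_variety_def quotient_fspace_def points_SL_variety fspace.select_convs mem_Collect_eq
      cell_preimage .
qed

end

section \<open>Polynomials on projective space\<close>

text \<open>Passes from exponent vectors to nested polynomials, which carry the unique
  factorisation.\<close>

definition ring3_of :: "nat cpoly \<Rightarrow> ring3" where
  "ring3_of p = (\<Sum>m\<in>Poly_Mapping.keys p. const (Poly_Mapping.lookup p m) *
     (\<Prod>i<3. var i ^ Poly_Mapping.lookup m i))"

lemma ev_ring3_of:
  assumes "p \<in> polys_in {..2}"
  shows "ev w (ring3_of p) = Defs.eval_poly p w"
proof -
  have "eval_monom m w = (\<Prod>i<3. w i ^ Poly_Mapping.lookup m i)" if "m \<in> Poly_Mapping.keys p" for m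
    using assms that by (intro eval_monom_superset) (fastforce simp: polys_in_def)+
  then show ?thesis
    by (simp add: ring3_of_def Defs.eval_poly_def ev.hom_sum ev.hom_mult ev.hom_prod ev.hom_power)
qed

definition proj_of :: "(nat \<Rightarrow> complex) \<Rightarrow> complex vec set" where
  "proj_of w = proj_point (vec 3 w)"

lemma eval_poly_cong:
  assumes "p \<in> polys_in I" "\<And>i. i \<in> I \<Longrightarrow> x i = y i"
  shows "Defs.eval_poly p x = Defs.eval_poly p y"
  unfolding Defs.eval_poly_def eval_monom_def
proof (intro sum.cong prod.cong refl arg_cong2[where f = "(*)"])
  fix m i assume "m \<in> Poly_Mapping.keys p" "i \<in> Poly_Mapping.keys m"
  then have "i \<in> I" using assms(1) by (auto simp: polys_in_def)
  then show "x i ^ Poly_Mapping.lookup m i = y i ^ Poly_Mapping.lookup m i" by (simp add: assms(2))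
qed

lemma eval_at_vec3:
  assumes "p \<in> polys_in {..2}"
  shows "eval_at_vec p (vec 3 w) = Defs.eval_poly p w"
  using assms by (rule eval_poly_cong) auto

lemma proj_of_in_points: "\<exists>i<3. w i \<noteq> 0 \<Longrightarrow> proj_of w \<in> proj_points 2"
proof -
  assume w: "\<exists>i<3. w i \<noteq> 0"
  then have "vec 3 w \<noteq> 0\<^sub>v 3" by (metis index_vec index_zero_vec(1))
  then show ?thesis unfolding proj_of_def proj_points_def by (intro imageI) simp
qed

lemma proj_points_proj_of: "L \<in> proj_points 2 \<Longrightarrow> \<exists>w. (\<exists>i<3. w i \<noteq> 0) \<and> L = proj_of w"
proof -
  assume "L \<in> proj_points 2"
  then obtain v where v: "v \<in> carrier_vec 3" "v \<noteq> 0\<^sub>v 3" "L = proj_point v"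
    by (auto simp: proj_points_def)
  then have "vec 3 (\<lambda>i. v $ i) = v" by auto
  moreover from v have "\<exists>i<3. v $ i \<noteq> 0" by (metis carrier_vecD eq_vecI index_zero_vec)
  ultimately show ?thesis using v(3) by (intro exI[of _ "\<lambda>i. v $ i"]) (simp add: proj_of_def)
qed

lemma proj_of_scale:
  assumes "t \<noteq> 0"
  shows "proj_of (\<lambda>i. t * w i) = proj_of w"
proof -
  have v: "vec 3 (\<lambda>i. t * w i) = t \<cdot>\<^sub>v vec 3 w" by auto
  show ?thesis
    unfolding proj_of_def proj_point_def v
  proof safe
    fix c :: complex assume "c \<noteq> 0"
    then show "\<exists>c'. c \<cdot>\<^sub>v (t \<cdot>\<^sub>v vec 3 w) = c' \<cdot>\<^sub>v vec 3 w \<and> c' \<noteq> 0"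
      using assms by (intro exI[of _ "c * t"]) (simp add: smult_smult_assoc)
    show "\<exists>c'. c \<cdot>\<^sub>v vec 3 w = c' \<cdot>\<^sub>v (t \<cdot>\<^sub>v vec 3 w) \<and> c' \<noteq> 0"
      using assms \<open>c \<noteq> 0\<close> by (intro exI[of _ "c / t"]) (simp add: smult_smult_assoc)
  qed
qed

text \<open>A neighbourhood in the projective plane contains a basic one, where a single form
  \<open>r\<close> is nonzero; on the punctured space three polynomials then describe the
  function.\<close>

lemma regular_local_quotient:
  assumes f: "f \<in> regular (proj_space 2) U" and w0: "proj_of w0 \<in> U"
  shows "\<exists>p q r. ev w0 r \<noteq> 0 \<and>
    (\<forall>w. (\<exists>i<3. w i \<noteq> 0) \<longrightarrow> ev w r \<noteq> 0 \<longrightarrow> proj_of w \<in> U \<and> ev w q \<noteq> 0 \<and> f (proj_of w) = ev w p / ev w q)"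
proof -
  obtain V d p q where pq: "p \<in> hom_polys_in {..2} d" "q \<in> hom_polys_in {..2} d" and V: "proj_open 2 V"
    "proj_of w0 \<in> V" "V \<subseteq> U"
    and all: "\<forall>M\<in>V. \<forall>v\<in>M. eval_at_vec q v \<noteq> 0 \<and> f M = eval_at_vec p v / eval_at_vec q v"
  proof -
    have "\<forall>L\<in>U. \<exists>V d. \<exists>p\<in>hom_polys_in {..2} d. \<exists>q\<in>hom_polys_in {..2} d.
        proj_open 2 V \<and> L \<in> V \<and> V \<subseteq> U \<and>
        (\<forall>M\<in>V. \<forall>v\<in>M. eval_at_vec q v \<noteq> 0 \<and> f M = eval_at_vec p v / eval_at_vec q v)"
      using f by (simp only: proj_space_def fspace.select_convs mem_Collect_eq)
    from bspec[OF this w0] show thesis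
      by (elim exE bexE conjE) (rule that; assumption)
  qed
  have fpq: "eval_at_vec q v \<noteq> 0 \<and> f M = eval_at_vec p v / eval_at_vec q v" if "M \<in> V" "v \<in> M" for M v
    using bspec[OF bspec[OF all that(1)] that(2)] .
  obtain F where F: "F \<subseteq> (\<Union>d. hom_polys_in {..2} d)"
      "V = {L \<in> proj_points 2. \<not> (\<forall>p\<in>F. \<forall>v\<in>L. eval_at_vec p v = 0)}"
    using V(1) unfolding proj_open_def by blast
  obtain r v where r: "r \<in> F" "v \<in> proj_of w0" "eval_at_vec r v \<noteq> 0" using V(2) unfolding F(2) by blast
  obtain e where e: "r \<in> hom_polys_in {..2} e" using r(1) F(1) by blast
  have P: "p \<in> polys_in {..2}" "q \<in> polys_in {..2}" "r \<in> polys_in {..2}"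
    using pq e by (auto simp: hom_polys_in_def)
  have "\<not> (\<forall>v\<in>proj_point (vec 3 w0). eval_at_vec r v = 0)" using r(2,3) unfolding proj_of_def by blast
  then have "eval_at_vec r (vec 3 w0) \<noteq> 0"
    using hom_vanish_proj_point[OF _ e, of "vec 3 w0"] by simp
  then have "ev w0 (ring3_of r) \<noteq> 0" unfolding ev_ring3_of[OF P(3)] eval_at_vec3[OF P(3)] .
  moreover have "proj_of w \<in> U \<and> ev w (ring3_of q) \<noteq> 0 \<and> f (proj_of w) = ev w (ring3_of p) / ev w (ring3_of q)"
    if w: "\<exists>i<3. w i \<noteq> 0" "ev w (ring3_of r) \<noteq> 0" for w
  proof -
    have self: "vec 3 w \<in> proj_of w" unfolding proj_of_def by (rule proj_point_self)
    have "eval_at_vec r (vec 3 w) \<noteq> 0" using w(2) unfolding ev_ring3_of[OF P(3)] eval_at_vec3[OF P(3)] .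
    then have "proj_of w \<in> V" unfolding F(2) using proj_of_in_points[OF w(1)] self r(1) by blast
    then show ?thesis
      using fpq[OF _ self] V(3) unfolding ev_ring3_of[OF P(1)] ev_ring3_of[OF P(2)]
        eval_at_vec3[OF P(1)] eval_at_vec3[OF P(2)] by blast
  qed
  ultimately show ?thesis by blast
qed

text \<open>\<open>Q\<close> is the product of all \<open>r i j\<close> and all denominators.
  \<open>E\<close> carries \<open>Q\<close> squared: one factor clears denominators, the other makes
  \<open>E\<close> vanish wherever \<open>Q\<close> does, so that a nonzero determinant of
  \<open>E\<close> forces \<open>Q\<close> to be nonzero.\<close>

lemma ex_matrix_of_quotients:
  fixes p q r :: "nat \<Rightarrow> nat \<Rightarrow> ring3"
  assumes n: "n > 0"
  obtains E Q where "E \<in> carrier_mat n n"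
    "\<And>w. ev w Q = 0 \<longleftrightarrow> (\<exists>i<n. \<exists>j<n. ev w (r i j) * ev w (q i j) = 0)"
    "\<And>w. map_mat (ev w) E = ev w Q ^ 2 \<cdot>\<^sub>m mat n n (\<lambda>(i, j). ev w (p i j) / ev w (q i j)) \<or> ev w Q = 0"
    "\<And>w. ev w Q = 0 \<Longrightarrow> map_mat (ev w) E = 0\<^sub>m n n"
proof -
  define I where "I = {..<n} \<times> {..<n}"
  define Q where "Q = (\<Prod>(i, j)\<in>I. r i j * q i j)"
  define E where "E = mat n n (\<lambda>(i, j). Q * (p i j * r i j * (\<Prod>(k, l)\<in>I - {(i, j)}. r k l * q k l)))"
  have Q: "ev w Q = 0 \<longleftrightarrow> (\<exists>i<n. \<exists>j<n. ev w (r i j) * ev w (q i j) = 0)" for w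
    by (auto simp: Q_def ev.hom_prod I_def split_def ev.hom_mult)
  have "map_mat (ev w) E = ev w Q ^ 2 \<cdot>\<^sub>m mat n n (\<lambda>(i, j). ev w (p i j) / ev w (q i j))" if "ev w Q \<noteq> 0" for w
  proof (rule eq_matI)
    fix i j assume "i < dim_row (ev w Q ^ 2 \<cdot>\<^sub>m mat n n (\<lambda>(i, j). ev w (p i j) / ev w (q i j)))"
      "j < dim_col (ev w Q ^ 2 \<cdot>\<^sub>m mat n n (\<lambda>(i, j). ev w (p i j) / ev w (q i j)))"
    then have ij: "i < n" "j < n" by auto
    have q0: "ev w (q i j) \<noteq> 0" using that ij Q by auto
    have "Q = r i j * q i j * (\<Prod>(k, l)\<in>I - {(i, j)}. r k l * q k l)"
      unfolding Q_def using ij by (subst prod.remove[of I "(i, j)"]) (auto simp: I_def)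
    then have "ev w Q = ev w (r i j) * ev w (q i j) * ev w (\<Prod>(k, l)\<in>I - {(i, j)}. r k l * q k l)"
      by (metis ev.hom_mult)
    then show "map_mat (ev w) E $$ (i, j) =
        (ev w Q ^ 2 \<cdot>\<^sub>m mat n n (\<lambda>(i, j). ev w (p i j) / ev w (q i j))) $$ (i, j)"
      using ij q0 by (simp add: E_def ev.hom_mult power2_eq_square)
  qed (auto simp: E_def)
  moreover have "map_mat (ev w) E = 0\<^sub>m n n" if "ev w Q = 0" for w
    by (rule eq_matI) (use that in \<open>auto simp: E_def ev.hom_mult\<close>)
  moreover have "E \<in> carrier_mat n n" by (simp add: E_def)
  ultimately show thesis using that[of E Q] Q by blast
qed

text \<open>Near \<open>proj_of w0\<close> the map stays in the open cell centred at its value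
  there, so \<open>a * L\<close>, with the cell coordinates as entries of \<open>L\<close>,
  represents it. Scaling by \<open>Q\<close> squared makes the entries polynomial and only rescales
  the triangular factor.\<close>

lemma local_polynomial_lift:
  assumes mor: "morphism (proj_space 2) (flag_variety n) \<phi>" and n: "n > 0"
    and g0: "\<And>w. \<exists>i<3. w i \<noteq> 0 \<Longrightarrow> g0 w \<in> carrier (SL n) \<and> \<phi> (proj_of w) = g0 w <#\<^bsub>SL n\<^esub> borel n"
    and w0: "\<exists>i<3. w0 i \<noteq> 0"
  shows "\<exists>G\<in>carrier_mat n n. ev w0 (det G) \<noteq> 0 \<and>
    (\<forall>w. (\<exists>i<3. w i \<noteq> 0) \<longrightarrow> ev w (det G) \<noteq> 0 \<longrightarrow>
      (\<exists>U\<in>carrier_mat n n. upper_triangular U \<and> map_mat (ev w) G = g0 w * U))"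
proof -
  define a where "a = g0 w0"
  have a: "a \<in> carrier (SL n)" using g0[OF w0] by (simp add: a_def)
  note ac = a_carrier[OF a]
  let ?U = "{x \<in> points (proj_space 2). \<phi> x \<in> cell n a}"
  have w0U: "proj_of w0 \<in> ?U"
    using g0[OF w0] coset_self_in_cell[OF a] proj_of_in_points[OF w0] unfolding points_proj_space a_def by simp
  define R where "R = (\<lambda>i j p q r. ev w0 r \<noteq> 0 \<and> (\<forall>w. (\<exists>i<3. w i \<noteq> 0) \<longrightarrow> ev w r \<noteq> 0 \<longrightarrow>
      proj_of w \<in> ?U \<and> ev w q \<noteq> 0 \<and> (cell_coord n a i j \<circ> \<phi>) (proj_of w) = ev w p / ev w q))"
  have "\<exists>p q r. R i j p q r" if "i < n" "j < n" for i j
    unfolding R_def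
  proof (rule regular_local_quotient[OF _ w0U])
    show "cell_coord n a i j \<circ> \<phi> \<in> regular (proj_space 2) ?U"
      using mor openin_cell[OF a] cell_coord_regular[OF a that] unfolding morphism_def by blast
  qed
  then obtain p q r where R: "\<And>i j. i < n \<Longrightarrow> j < n \<Longrightarrow> R i j (p i j) (q i j) (r i j)" by metis
  have r0: "ev w0 (r i j) \<noteq> 0" if "i < n" "j < n" for i j
    using R[OF that] by (simp add: R_def)
  have loc: "proj_of w \<in> ?U \<and> ev w (q i j) \<noteq> 0 \<and> cell_coord n a i j (\<phi> (proj_of w)) = ev w (p i j) / ev w (q i j)"
    if "i < n" "j < n" "\<exists>i<3. w i \<noteq> 0" "ev w (r i j) \<noteq> 0" for i j w
    using conjunct2[OF R[OF that(1,2), unfolded R_def]] that(3,4) unfolding o_def by blast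
  obtain E Q where E: "E \<in> carrier_mat n n"
    and Q: "\<And>w. ev w Q = 0 \<longleftrightarrow> (\<exists>i<n. \<exists>j<n. ev w (r i j) * ev w (q i j) = 0)"
    and evE: "\<And>w. map_mat (ev w) E = ev w Q ^ 2 \<cdot>\<^sub>m mat n n (\<lambda>(i, j). ev w (p i j) / ev w (q i j)) \<or> ev w Q = 0"
    and evE0: "\<And>w. ev w Q = 0 \<Longrightarrow> map_mat (ev w) E = 0\<^sub>m n n"
  proof (rule ex_matrix_of_quotients[OF n, where p = p and q = q and r = r], goal_cases)
    case (1 E Q)
    show ?case by (rule 1(1)[OF 1(2-5)])
  qed
  have Q0: "ev w0 Q \<noteq> 0" unfolding Q using r0 loc[OF _ _ w0] by auto
  define L where "L = (\<lambda>w. mat n n (\<lambda>(i, j). cell_coord n a i j (\<phi> (proj_of w))))"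
  have Lc: "L w \<in> carrier_mat n n" for w by (simp add: L_def)
  have L: "lower_unitriangular n (L w)" "a * L w \<in> \<phi> (proj_of w)" "map_mat (ev w) E = ev w Q ^ 2 \<cdot>\<^sub>m L w"
    if w: "\<exists>i<3. w i \<noteq> 0" and Qw: "ev w Q \<noteq> 0" for w
  proof -
    have r: "ev w (r i j) \<noteq> 0" if "i < n" "j < n" for i j using Qw that unfolding Q by auto
    have "\<phi> (proj_of w) \<in> cell n a" using loc[OF n n w r[OF n n]] by simp
    then show "lower_unitriangular n (L w)" "a * L w \<in> \<phi> (proj_of w)"
      unfolding L_def using cell_coord_mat[OF a] by blast+
    have "mat n n (\<lambda>(i, j). ev w (p i j) / ev w (q i j)) = L w"
      unfolding L_def using loc[OF _ _ w r] by (intro eq_matI) auto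
    then show "map_mat (ev w) E = ev w Q ^ 2 \<cdot>\<^sub>m L w" using evE[of w] Qw by simp
  qed
  define G where "G = map_mat const a * E"
  have ca: "map_mat const a \<in> carrier_mat n n" using ac by simp
  have G: "G \<in> carrier_mat n n" unfolding G_def by (rule mult_carrier_mat[OF ca E])
  have evG: "map_mat (ev w) G = a * map_mat (ev w) E" for w
  proof -
    have "map_mat (ev w) (map_mat const a) = a" by (rule eq_matI) auto
    then show ?thesis unfolding G_def ev.mat_hom_mult[OF ca E] by simp
  qed
  have detG: "ev w (det G) = det (map_mat (ev w) E)" for w
  proof -
    have "ev w (det G) = det (map_mat (ev w) G)" by simp
    also have "\<dots> = det (map_mat (ev w) E)"
      unfolding evG using E ac(2) by (subst det_mult[OF ac(1)]) auto
    finally show ?thesis .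
  qed
  have "det (map_mat (ev w0) E) = (ev w0 Q ^ 2) ^ n"
    unfolding L(3)[OF w0 Q0] using det_lower_unitriangular[OF L(1)[OF w0 Q0]] Lc[of w0]
    by (simp add: det_smult)
  then have "ev w0 (det G) \<noteq> 0" unfolding detG using Q0 by simp
  moreover have "\<exists>U\<in>carrier_mat n n. upper_triangular U \<and> map_mat (ev w) G = g0 w * U"
    if w: "\<exists>i<3. w i \<noteq> 0" and d: "ev w (det G) \<noteq> 0" for w
  proof -
    have Qw: "ev w Q \<noteq> 0"
    proof
      assume "ev w Q = 0"
      then have "ev w (det G) = det (0\<^sub>m n n :: complex mat)" unfolding detG by (simp add: evE0)
      also have "\<dots> = 0" using n by (intro det_zero) auto
      finally show False using d by simp
    qed
    obtain b where b: "b \<in> borel n" "a * L w = g0 w * b"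
      using L(2)[OF w Qw] g0[OF w] mem_coset by auto
    have bc: "b \<in> carrier_mat n n" "upper_triangular b" using b(1) by (auto simp: mem_borel)
    have gc: "g0 w \<in> carrier_mat n n" using g0[OF w] by (simp add: SL_simps)
    have "map_mat (ev w) G = g0 w * (ev w Q ^ 2 \<cdot>\<^sub>m b)"
      unfolding evG L(3)[OF w Qw] mult_smult_distrib[OF ac(1) Lc] mult_smult_distrib[OF gc bc(1)] b(2) ..
    moreover have "upper_triangular (ev w Q ^ 2 \<cdot>\<^sub>m b)"
      using upper_triangularD[OF bc(2)] bc(1) by (auto intro!: upper_triangularI)
    moreover have "ev w Q ^ 2 \<cdot>\<^sub>m b \<in> carrier_mat n n" using bc(1) by simp
    ultimately show ?thesis by blast
  qed
  ultimately show ?thesis using G by blast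
qed

theorem theorem1p1:
  fixes n :: nat
  assumes "n \<ge> 2"
  shows "\<not> (\<exists>\<phi>. morphism (proj_space 2) (flag_variety n) \<phi> \<and>
                 \<not> \<phi> constant_on points (proj_space 2))"
proof (rule notI, elim exE conjE)
  fix \<phi>
  assume mor: "morphism (proj_space 2) (flag_variety n) \<phi>" and nc: "\<not> \<phi> constant_on points (proj_space 2)"
  have n: "n > 0" using assms by simp
  have "\<exists>g. g \<in> carrier (SL n) \<and> \<phi> M = g <#\<^bsub>SL n\<^esub> borel n" if "M \<in> proj_points 2" for M
  proof -
    have "\<phi> M \<in> points (flag_variety n)"
      using mor that unfolding morphism_def continuous_map_def points_def[symmetric] points_proj_space by blast
    then show ?thesis unfolding points_flag_variety by blast
  qed
  then obtain \<gamma> where \<gamma>: "\<And>M. M \<in> proj_points 2 \<Longrightarrow> \<gamma> M \<in> carrier (SL n) \<and> \<phi> M = \<gamma> M <#\<^bsub>SL n\<^esub> borel n"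
    by metis
  \<comment> \<open>One representative is chosen for each point of the projective plane, so
    \<open>g0\<close> is invariant under scaling by construction; the choice need not be
    continuous.\<close>
  define g0 where "g0 = (\<lambda>w. \<gamma> (proj_of w))"
  have g0: "g0 w \<in> carrier (SL n) \<and> \<phi> (proj_of w) = g0 w <#\<^bsub>SL n\<^esub> borel n" if "\<exists>i<3. w i \<noteq> 0" for w
    unfolding g0_def by (rule \<gamma>[OF proj_of_in_points[OF that]])
  have "\<exists>h\<in>carrier_mat n n. \<forall>w. (\<exists>i<3. w i \<noteq> 0) \<longrightarrow>
      (\<exists>U\<in>carrier_mat n n. upper_triangular U \<and> g0 w = h * U)"
  proof (rule homogeneous_flag_constant)
    show "g0 w \<in> carrier_mat n n" "det (g0 w) \<noteq> 0" if "\<exists>i<3. w i \<noteq> 0" for w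
      using g0[OF that] by (auto simp: SL_simps)
    show "g0 (\<lambda>i. t * w i) = g0 w" if "t \<noteq> 0" for w t
      unfolding g0_def proj_of_scale[OF that] ..
  qed (rule local_polynomial_lift[OF mor n g0])
  then obtain h where h: "h \<in> carrier_mat n n" and hU: "\<And>w. \<exists>i<3. w i \<noteq> 0 \<Longrightarrow>
      \<exists>U\<in>carrier_mat n n. upper_triangular U \<and> g0 w = h * U" by blast
  have eq: "\<phi> (proj_of w) = \<phi> (proj_of w')" if w: "\<exists>i<3. w i \<noteq> 0" and w': "\<exists>i<3. w' i \<noteq> 0" for w w'
  proof -
    obtain U where U: "U \<in> carrier_mat n n" "upper_triangular U" "g0 w = h * U" using hU[OF w] by blast
    obtain U' where U': "U' \<in> carrier_mat n n" "upper_triangular U'" "g0 w' = h * U'" using hU[OF w'] by blast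
    have c: "g0 w \<in> carrier_mat n n" "det (g0 w) = 1" "g0 w' \<in> carrier_mat n n" "det (g0 w') = 1"
      using g0[OF w] g0[OF w'] by (auto simp: SL_simps)
    have "det h * det U = 1" using c(2) unfolding U(3) by (simp add: det_mult[OF h U(1)])
    then have d: "det h \<noteq> 0" "det U \<noteq> 0" by auto
    note A = adj_mat(1)[OF c(1)]
    \<comment> \<open>The determinant of \<open>h\<close> need not be 1, so the two cosets are
      compared directly: \<open>b\<close> is the quotient of their representatives, and
      \<open>U * b = U'\<close> makes it triangular.\<close>
    define b where "b = adj_mat (g0 w) * g0 w'"
    have b: "b \<in> carrier_mat n n" unfolding b_def by (rule mult_carrier_mat[OF A c(3)])
    have gb: "g0 w * b = g0 w'"
    proof -
      have "g0 w * b = g0 w * adj_mat (g0 w) * g0 w'"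
        unfolding b_def by (rule assoc_mult_mat[symmetric, OF c(1) A c(3)])
      then show ?thesis unfolding mult_adj_mat_SL(1)[OF c(1,2)] left_mult_one_mat[OF c(3)] .
    qed
    have "h * (U * b) = h * U'"
      using gb unfolding U(3) U'(3) assoc_mult_mat[OF h U(1) b] .
    then have "U * b = U'"
      by (rule mat_cancel_left[OF h d(1) mult_carrier_mat[OF U(1) b] U'(1)])
    then have "upper_triangular b"
      using U'(2) by (intro upper_triangular_cancel_left[OF b U(1,2) d(2)]) simp
    moreover have "det b = 1"
      using c(2,4) det_mult[OF c(1) b] unfolding gb by simp
    ultimately have "b \<in> borel n" using b by (simp add: mem_borel)
    then have "g0 w' <#\<^bsub>SL n\<^esub> borel n = g0 w <#\<^bsub>SL n\<^esub> borel n"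
      unfolding gb[symmetric] by (rule coset_mult_borel[OF c(1)])
    then show ?thesis using g0[OF w] g0[OF w'] by simp
  qed
  have "\<phi> M = \<phi> (proj_of (\<lambda>_. 1))" if M: "M \<in> proj_points 2" for M
  proof -
    have one: "\<exists>i<3::nat. (1::complex) \<noteq> 0" by (intro exI[of _ 0]) simp
    obtain w where "\<exists>i<3. w i \<noteq> 0" "M = proj_of w" using proj_points_proj_of[OF M] by blast
    then show ?thesis using eq[OF _ one] by simp
  qed
  then have "\<phi> constant_on points (proj_space 2)"
    unfolding points_proj_space constant_on_def by blast
  with nc show False by contradiction
qed

end
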